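(* For every integer $n\ge 2$, the number $$\alpha_n^*=2+[0;\underbrace{1,\ldots,1}_{2n-2},\overline{2,2,1,2}]+[0;\underbrace{1,\ldots,1}_{2n-1},2,\underbrace{1,\ldots,1}_{2n-2},\overline{2,2,1,2}]$$ is not admissible.
   Context: For irrational $\alpha$, $\mu(\alpha)=\bigl(\liminf_{p\in\mathbb{Z},q\in\mathbb{N}}|q(q\alpha-p)|\bigr)^{-1}$; the Lagrange spectrum $\mathbb{L}$ is the set of these values. An irrational $\alpha$ is attainable if $|\alpha-p/q|\le 1/(\mu(\alpha)q^2)$ has infinitely many integer solutions $p,q$ ($q\ge1$). A real $\lambda\in\mathbb{L}$ is admissible if there exists an irrational attainable $\alpha$ with $\mu(\alpha)=\lambda$. The overline denotes an infinitely repeated period in the continued fraction. *)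

theory Defs
  imports "HOL-Analysis.Analysis" "HOL-Library.Stream"
begin

text \<open>
  The Lagrange constant of \<open>\<alpha>\<close> is the inverse of the lower limit of \<open>|q (q \<alpha> - p)|\<close> over all pairs
  \<open>(p, q)\<close> with \<open>p\<close> an integer and \<open>q \<ge> 1\<close>; a lower limit over a countable family without a
  preferred order is taken along the cofinite filter.  It is extended-real-valued because the lower
  limit may be \<open>0\<close>, in which case the constant is \<open>\<infinity>\<close> (for \<open>ereal\<close>, \<open>inverse 0 = \<infinity>\<close>).
\<close>

definition lagrange_const :: "real \<Rightarrow> ereal" where
  "lagrange_const \<alpha> =
     inverse (Liminf (inf cofinite (principal {(p :: int, q :: nat). q \<ge> 1}))
       (\<lambda>(p, q). ereal \<bar>real q * (real q * \<alpha> - real_of_int p)\<bar>))"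

definition lagrange_spectrum :: "ereal set" where
  "lagrange_spectrum = lagrange_const ` {\<alpha>. \<alpha> \<notin> \<rat>}"

definition attainable :: "real \<Rightarrow> bool" where
  "attainable \<alpha> \<longleftrightarrow> \<alpha> \<notin> \<rat> \<and>
     infinite {(p :: int, q :: nat). q \<ge> 1 \<and>
       ereal \<bar>\<alpha> - real_of_int p / real q\<bar> \<le> 1 / (lagrange_const \<alpha> * ereal ((real q)\<^sup>2))}"

definition admissible :: "real \<Rightarrow> bool" where
  "admissible l \<longleftrightarrow> ereal l \<in> lagrange_spectrum \<and>
     (\<exists>\<alpha>. \<alpha> \<notin> \<rat> \<and> attainable \<alpha> \<and> lagrange_const \<alpha> = ereal l)"

fun cfrac_fin :: "nat \<Rightarrow> nat list \<Rightarrow> real" where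
  "cfrac_fin a [] = real a"
| "cfrac_fin a (b # bs) = real a + 1 / cfrac_fin b bs"

text \<open>\<open>cfrac a s\<close> is the infinite continued fraction \<open>[a; s\<^sub>0, s\<^sub>1, \<dots>]\<close>.\<close>

definition cfrac :: "nat \<Rightarrow> nat stream \<Rightarrow> real" where
  "cfrac a s = lim (\<lambda>k. cfrac_fin a (stake k s))"

definition alpha_star :: "nat \<Rightarrow> real" where
  "alpha_star n =
     2 + cfrac 0 (replicate (2 * n - 2) 1 @- cycle [2, 2, 1, 2])
       + cfrac 0 ((replicate (2 * n - 1) 1 @ [2] @ replicate (2 * n - 2) 1) @- cycle [2, 2, 1, 2])"

end

theory Submission
  imports Defs "HOL-Number_Theory.Fib"
begin

text \<open>
  Write \<open>\<lambda> i = [a i; a (i + 1), \<dots>] + [0; a (i - 1), \<dots>, a 1]\<close> for the partial quotients \<open>a i\<close> of \<open>\<alpha>\<close>. If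
  \<open>\<alpha>\<close> were attainable with constant \<open>\<alpha>*\<close>, then limsup \<open>\<lambda> i = \<alpha>*\<close> and, by Legendre's criterion,
  \<open>\<lambda> i \<ge> \<alpha>*\<close> for infinitely many \<open>i\<close>. The upper limit makes the partial quotients eventually 1 or 2 and
  forbids every word on which \<open>\<lambda>\<close> exceeds \<open>\<alpha>*\<close> by a fixed margin. Comparing the lengths of the two runs
  of ones next to a 2, the forbidden words leave only one way to have \<open>\<lambda> i \<ge> \<alpha>*\<close>: up to reflection,
  \<open>a i\<close> is followed by \<open>2n-2\<close> ones and a 2, and preceded by \<open>2n-1\<close> ones and a 2, which in turn is
  preceded by \<open>2n-2\<close> ones and a 2. Both outer tails are at most \<open>[0; 2, 2, 1, 2, \<dots>]\<close>, the largest value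
  compatible with the forbidden words, and \<open>\<alpha>*\<close> is the value of \<open>\<lambda>\<close> when both are equal to it. So one
  of them has to follow the period 2, 2, 1, 2 as long as the words are forbidden. The period has
  no two consecutive ones, hence this excludes further indices with \<open>\<lambda> \<ge> \<alpha>*\<close> on that side, and three
  such indices far apart are impossible.
\<close>

subsection \<open>Iterates of \<open>x \<mapsto> 1 / (1 + x)\<close>\<close>

text \<open>Puts a digit 1 in front of a tail \<open>x\<close> = [0; c, d, ...], so
  \<open>(gstep ^^ k) x\<close> is that tail preceded by a run of \<open>k\<close> ones.\<close>

definition gstep :: "real \<Rightarrow> real" where
  "gstep x = 1 / (1 + x)"

lemma gstep_pow_nonneg: "0 \<le> x \<Longrightarrow> 0 \<le> (gstep ^^ k) x"
  by (induction k) (auto simp: gstep_def)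

text \<open>The \<open>k\<close>-th iterate is a Moebius map of determinant \<open>(-1) ^ k\<close>
  with denominator \<open>fib k * x + fib (Suc k)\<close>. The sign is why runs of even and odd
  length behave differently.\<close>

lemma gstep_pow_diff:
  fixes x y :: real
  assumes "0 \<le> x" "0 \<le> y"
  shows "(gstep ^^ k) x - (gstep ^^ k) y =
    (-1) ^ k * (x - y) / ((fib k * x + fib (Suc k)) * (fib k * y + fib (Suc k)))"
  using assms
proof (induction k arbitrary: x y)
  case 0
  then show ?case by simp
next
  case (Suc k)
  define c d where "c = real (fib k)" and "d = real (fib (Suc k))"
  have c: "0 \<le> c" and d: "0 < d"
    using fib_neq_0_nat[of "Suc k"] by (auto simp: c_def d_def)
  have f: "real (fib (Suc (Suc k))) = c + d"
    by (simp add: c_def d_def)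
  have g: "0 \<le> gstep x" "0 \<le> gstep y" using Suc.prems by (auto simp: gstep_def)
  have pos: "0 < d * x + (c + d)" "0 < d * y + (c + d)"
    using c d Suc.prems by (auto intro!: add_nonneg_pos)
  have e1: "c * gstep x + d = (d * x + (c + d)) / (1 + x)"
    and e2: "c * gstep y + d = (d * y + (c + d)) / (1 + y)"
    using Suc.prems by (auto simp: gstep_def field_simps)
  have e3: "gstep x - gstep y = - (x - y) / ((1 + x) * (1 + y))"
    using Suc.prems by (auto simp: gstep_def field_simps)
  have "(gstep ^^ Suc k) x - (gstep ^^ Suc k) y = (gstep ^^ k) (gstep x) - (gstep ^^ k) (gstep y)"
    by (simp only: funpow_Suc_right o_apply)
  also have "\<dots> = (-1) ^ k * (gstep x - gstep y) / ((c * gstep x + d) * (c * gstep y + d))"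
    using Suc.IH[OF g] by (simp add: c_def d_def)
  also have "\<dots> = (-1) ^ Suc k * (x - y) / ((d * x + (c + d)) * (d * y + (c + d)))"
  proof -
    have "e * (- w / (a * b)) / (A / a * (B / b)) = - e * w / (A * B)"
      if "a \<noteq> 0" "b \<noteq> 0" for e w a b A B :: real using that by simp
    from this[of "1 + x" "1 + y" "(-1) ^ k" "x - y"] show ?thesis
      unfolding e1 e2 e3 using Suc.prems by simp
  qed
  finally show ?case unfolding f d_def[symmetric] .
qed

lemma gstep_pow_less_iff_even:
  assumes "even k" "0 \<le> x" "0 \<le> y"
  shows "(gstep ^^ k) x < (gstep ^^ k) y \<longleftrightarrow> x < y"
proof -
  have d: "0 < real (fib (Suc k))" using fib_neq_0_nat[of "Suc k"] by simp
  define A where "A = (fib k * x + fib (Suc k)) * (fib k * y + fib (Suc k))"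
  have "0 < A" unfolding A_def using d assms(2,3) by (intro mult_pos_pos add_nonneg_pos) auto
  moreover have "(gstep ^^ k) x - (gstep ^^ k) y = (x - y) / A"
    using gstep_pow_diff[OF assms(2,3), of k] \<open>even k\<close> by (simp add: A_def)
  ultimately show ?thesis
    by (metis diff_gt_0_iff_gt diff_less_0_iff_less divide_less_0_iff not_less_iff_gr_or_eq)
qed

text \<open>
  A margin by which \<open>\<lambda>\<close> exceeds \<open>alpha_star n\<close> at every forbidden word. The denominators of
  \<open>gstep ^^ k\<close> with \<open>k \<le> 2 n - 2\<close> are bounded by \<open>fib (2 n)\<close>, and \<open>1 / 1000\<close> is a lower bound for the
  differences of the innermost tails that have to be compared.
\<close>

definition gap :: "nat \<Rightarrow> real" where
  "gap n = 1 / (1000 * (real (fib (2 * n)))\<^sup>2)"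

lemma gap_pos: "n \<ge> 1 \<Longrightarrow> 0 < gap n"
  using fib_neq_0_nat[of "2 * n"] by (auto simp: gap_def)

lemma gap_le: "n \<ge> 1 \<Longrightarrow> gap n \<le> 1 / 1000"
proof -
  assume "n \<ge> 1"
  then have "1 \<le> real (fib (2 * n))" using fib_neq_0_nat[of "2 * n"] by simp
  then have "1 \<le> (real (fib (2 * n)))\<^sup>2" by (simp add: one_le_power)
  then have "inverse ((real (fib (2 * n)))\<^sup>2) \<le> 1" by (rule inverse_le_1_iff[THEN iffD2, OF disjI2])
  then show ?thesis by (simp add: gap_def inverse_eq_divide)
qed

text \<open>After \<open>gstep_pow_diff\<close> the two differences have denominators
  \<open>A\<close> and \<open>B\<close>, with \<open>A \<le> B\<close> because the smaller tails are
  paired. A possible loss \<open>z' - q\<close> thus weighs no more than the gain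
  \<open>p - z\<close>.\<close>

lemma gstep_pow_sum_gap_ordered:
  assumes k: "k + 2 \<le> 2 * n" and z: "0 \<le> z" "z \<le> z'" "z \<le> 1" "z' \<le> 1"
    and pq: "p \<le> q" "p \<le> 1"
    and gaps: "z + z' + 1 / 1000 \<le> p + q" "z + 1 / 1000 \<le> p"
  shows "gap n \<le> (-1) ^ k * ((gstep ^^ k) p + (gstep ^^ k) q - (gstep ^^ k) z - (gstep ^^ k) z')"
proof -
  define c d where "c = real (fib k)" and "d = real (fib (Suc k))"
  have c: "0 \<le> c" and d: "0 < d"
    using fib_neq_0_nat[of "Suc k"] by (auto simp: c_def d_def)
  define A B where "A = (c * p + d) * (c * z + d)" and "B = (c * q + d) * (c * z' + d)"
  have nn: "0 \<le> p" "0 \<le> q" "0 \<le> z'" using z pq gaps by auto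
  have A: "0 < A" unfolding A_def using c d nn z by (intro mult_pos_pos add_nonneg_pos) auto
  have AB: "A \<le> B" unfolding A_def B_def using c d nn z pq
    by (intro mult_mono add_mono mult_left_mono) auto
  \<comment> \<open>The hypothesis \<open>k + 2 \<le> 2 * n\<close> enters here, since
    \<open>c + d\<close> is \<open>fib (k + 2)\<close>.\<close>
  have fm: "c + d \<le> real (fib (2 * n))"
  proof -
    have "fib (k + 2) \<le> fib (2 * n)" using k by (intro fib_mono) auto
    moreover have "real (fib (k + 2)) = c + d" by (simp add: c_def d_def)
    ultimately show ?thesis by (metis of_nat_le_iff)
  qed
  have "c * p \<le> c" "c * z \<le> c" using c z pq by (auto intro: mult_left_le)
  then have "A \<le> (c + d) * (c + d)"
    unfolding A_def using c d nn z by (intro mult_mono) auto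
  also have "\<dots> \<le> (real (fib (2 * n)))\<^sup>2"
    unfolding power2_eq_square using fm c d by (intro mult_mono) auto
  finally have Af: "A \<le> (real (fib (2 * n)))\<^sup>2" .
  have s: "(-1::real) ^ k * (-1) ^ k = 1" by (simp flip: power_add)
  have e1: "(gstep ^^ k) p - (gstep ^^ k) z = (-1) ^ k * ((p - z) / A)"
    using gstep_pow_diff[OF nn(1) z(1), of k] by (simp add: A_def c_def d_def)
  have e2: "(gstep ^^ k) q - (gstep ^^ k) z' = (-1) ^ k * ((q - z') / B)"
    using gstep_pow_diff[OF nn(2,3), of k] by (simp add: B_def c_def d_def)
  have "(gstep ^^ k) p + (gstep ^^ k) q - (gstep ^^ k) z - (gstep ^^ k) z' =
      ((gstep ^^ k) p - (gstep ^^ k) z) + ((gstep ^^ k) q - (gstep ^^ k) z')" by simp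
  also have "\<dots> = (-1) ^ k * ((p - z) / A + (q - z') / B)"
    unfolding e1 e2 by (simp add: algebra_simps)
  finally have eq: "(-1) ^ k * ((gstep ^^ k) p + (gstep ^^ k) q - (gstep ^^ k) z - (gstep ^^ k) z')
      = (p - z) / A + (q - z') / B"
    using s by (simp flip: mult.assoc)
  have "1 / 1000 / A \<le> (p - z) / A + (q - z') / B"
  proof (cases "z' \<le> q")
    case True
    have "1 / 1000 / A \<le> (p - z) / A" using gaps A by (intro divide_right_mono) auto
    moreover have "0 \<le> (q - z') / B" using True A AB by auto
    ultimately show ?thesis by linarith
  next
    case False
    have "(z' - q) / B \<le> (z' - q) / A" using False A AB by (intro divide_left_mono) auto
    moreover have "1 / 1000 / A \<le> ((p - z) - (z' - q)) / A"
      using gaps A by (intro divide_right_mono) auto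
    ultimately show ?thesis by (simp add: diff_divide_distrib add_divide_distrib)
  qed
  moreover have "gap n \<le> 1 / 1000 / A"
    unfolding gap_def using frac_le[of 1 1 A, OF _ _ A Af] by simp
  ultimately show ?thesis unfolding eq by linarith
qed

lemma gstep_pow_sum_gap:
  assumes k: "k + 2 \<le> 2 * n" and z: "0 \<le> z" "z \<le> 1" "0 \<le> z'" "z' \<le> 1"
    and pq: "p \<le> 1" "q \<le> 1"
    and gaps: "z + z' + 1 / 1000 \<le> p + q" "z + 1 / 1000 \<le> p" "z + 1 / 1000 \<le> q"
  shows "gap n \<le> (-1) ^ k * ((gstep ^^ k) p + (gstep ^^ k) q - (gstep ^^ k) z - (gstep ^^ k) z')"
proof -
  define lo hi where "lo = min z z'" and "hi = max z z'"
  define lo' hi' where "lo' = min p q" and "hi' = max p q"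
  have e: "(gstep ^^ k) p + (gstep ^^ k) q - (gstep ^^ k) z - (gstep ^^ k) z' =
     (gstep ^^ k) lo' + (gstep ^^ k) hi' - (gstep ^^ k) lo - (gstep ^^ k) hi"
    by (auto simp: lo_def hi_def lo'_def hi'_def min_def max_def)
  show ?thesis unfolding e
    using assms by (intro gstep_pow_sum_gap_ordered)
      (auto simp: lo_def hi_def lo'_def hi'_def min_def max_def)
qed

text \<open>The value \<open>[0; 2, 2, 1, 2, 2, 2, 1, 2, \<dots>]\<close>, which solves \<open>7 x\<^sup>2 + 16 x = 8\<close>.\<close>

definition per_tail :: real where
  "per_tail = (sqrt 120 - 8) / 7"

lemma per_tail_quadratic: "7 * per_tail\<^sup>2 + 16 * per_tail = 8"
proof -
  have "7 * per_tail + 8 = sqrt 120" by (simp add: per_tail_def field_simps)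
  then have "(7 * per_tail + 8)\<^sup>2 = 120" by simp
  then show ?thesis by (simp add: power2_eq_square algebra_simps)
qed

lemma per_tail_bounds: "4 / 11 \<le> per_tail" "per_tail \<le> 11 / 26"
proof -
  have "116 / 11 \<le> sqrt 120"
    by (rule real_le_rsqrt) (simp add: power2_eq_square)
  moreover have "sqrt 120 \<le> 285 / 26"
    by (rule real_le_lsqrt) (simp_all add: power2_eq_square)
  ultimately show "4 / 11 \<le> per_tail" "per_tail \<le> 11 / 26"
    unfolding per_tail_def by simp_all
qed

lemma per_tail_fixpoint:
  "per_tail = 1 / (2 + 1 / (2 + 1 / (1 + 1 / (2 + per_tail))))"
proof -
  note b = per_tail_bounds
  have "1 / (2 + 1 / (2 + 1 / (1 + 1 / (2 + per_tail)))) = (8 + 3 * per_tail) / (19 + 7 * per_tail)"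
    using b by (simp add: divide_simps)
  also have "\<dots> = per_tail"
    using b per_tail_quadratic by (simp add: field_simps power2_eq_square)
  finally show ?thesis by simp
qed

section \<open>Interval bounds for tails\<close>

lemma inverse_add_bounds:
  fixes x c :: real
  assumes "l \<le> x" "x \<le> h" "0 < c + l"
  shows "1 / (c + h) \<le> 1 / (c + x)" "1 / (c + x) \<le> 1 / (c + l)"
  using assms by (auto intro!: divide_left_mono mult_pos_pos)

lemma gstep_bounds:
  assumes "l \<le> x" "x \<le> h" "0 \<le> l"
  shows "1 / (1 + h) \<le> gstep x" "gstep x \<le> 1 / (1 + l)"
  using inverse_add_bounds[of l x h 1] assms by (auto simp: gstep_def)

text \<open>The interval is mapped into itself: 1/(1 + 4/11) = 11/15 and 1/(1 + 11/15) = 15/26 >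
  4/11. Further applications of \<open>gstep\<close> to these endpoints give the constants 26/41 and
  41/67 used below.\<close>

lemma gstep_pow_bounds:
  assumes "4 / 11 \<le> x" "x \<le> 11 / 15"
  shows "4 / 11 \<le> (gstep ^^ k) x \<and> (gstep ^^ k) x \<le> 11 / 15"
proof (induction k)
  case (Suc k)
  then show ?case using gstep_bounds[of "4 / 11" "(gstep ^^ k) x" "11 / 15"] by auto
qed (use assms in auto)

lemma gstep_pow_bounds1:
  assumes "4 / 11 \<le> x" "x \<le> 11 / 15" "1 \<le> k"
  shows "15 / 26 \<le> (gstep ^^ k) x \<and> (gstep ^^ k) x \<le> 11 / 15"
proof -
  obtain j where k: "k = Suc j" using assms(3) by (cases k) auto
  show ?thesis unfolding k
    using gstep_bounds[of "4 / 11" "(gstep ^^ j) x" "11 / 15"] gstep_pow_bounds[OF assms(1,2), of j]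
    by auto
qed

lemma gstep_pow_bounds2:
  assumes "4 / 11 \<le> x" "x \<le> 11 / 15" "2 \<le> k"
  shows "15 / 26 \<le> (gstep ^^ k) x \<and> (gstep ^^ k) x \<le> 26 / 41"
proof -
  obtain j where k: "k = Suc j" "1 \<le> j" using assms(3) by (cases k) auto
  show ?thesis unfolding k
    using gstep_bounds[of "15 / 26" "(gstep ^^ j) x" "11 / 15"] gstep_pow_bounds1[OF assms(1,2) k(2)]
    by auto
qed

lemma gstep_pow_bounds3:
  assumes "4 / 11 \<le> x" "x \<le> 11 / 15" "3 \<le> k"
  shows "41 / 67 \<le> (gstep ^^ k) x \<and> (gstep ^^ k) x \<le> 26 / 41"
proof -
  obtain j where k: "k = Suc j" "2 \<le> j" using assms(3) by (cases k) auto
  show ?thesis unfolding k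
    using gstep_bounds[of "15 / 26" "(gstep ^^ j) x" "26 / 41"] gstep_pow_bounds2[OF assms(1,2) k(2)]
    by auto
qed

subsection \<open>The value of \<open>alpha_star\<close>\<close>

lemma cfrac_fin_split: "cfrac_fin a bs = real a + cfrac_fin 0 bs"
  by (cases bs) auto

lemma cfrac_fin_nonneg: "0 \<le> cfrac_fin a bs"
  by (induction a bs rule: cfrac_fin.induct) auto

lemma cfrac_fin_le_1: "0 \<notin> set bs \<Longrightarrow> cfrac_fin 0 bs \<le> 1"
proof (cases bs)
  case (Cons b cs)
  assume "0 \<notin> set bs"
  then have "1 \<le> cfrac_fin b cs"
    using Cons cfrac_fin_split[of b cs] cfrac_fin_nonneg[of 0 cs] by (cases b) auto
  then show ?thesis using Cons by simp
qed simp

lemma cfrac_fin_SCons_LIMSEQ: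
  assumes "(\<lambda>k. cfrac_fin 0 (stake k s)) \<longlonglongrightarrow> v" "1 \<le> c" "0 \<le> v"
  shows "(\<lambda>k. cfrac_fin 0 (stake k (c ## s))) \<longlonglongrightarrow> 1 / (real c + v)"
proof (rule LIMSEQ_imp_Suc)
  have "(\<lambda>k. 1 / (real c + cfrac_fin 0 (stake k s))) \<longlonglongrightarrow> 1 / (real c + v)"
    using assms by (intro tendsto_intros) auto
  then show "(\<lambda>k. cfrac_fin 0 (stake (Suc k) (c ## s))) \<longlonglongrightarrow> 1 / (real c + v)"
    by (simp add: cfrac_fin_split[of c])
qed

lemma cfrac_fin_ones_LIMSEQ:
  assumes "(\<lambda>k. cfrac_fin 0 (stake k s)) \<longlonglongrightarrow> v" "0 \<le> v"
  shows "(\<lambda>k. cfrac_fin 0 (stake k (replicate m 1 @- s))) \<longlonglongrightarrow> (gstep ^^ m) v"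
proof (induction m)
  case (Suc m)
  have "(\<lambda>k. cfrac_fin 0 (stake k (1 ## (replicate m 1 @- s)))) \<longlonglongrightarrow> 1 / (real 1 + (gstep ^^ m) v)"
    by (intro cfrac_fin_SCons_LIMSEQ Suc gstep_pow_nonneg assms) simp
  moreover have "1 / (real 1 + (gstep ^^ m) v) = (gstep ^^ Suc m) v"
    by (simp add: gstep_def[of "(gstep ^^ m) v"])
  ultimately show ?case by simp
qed (use assms in auto)

lemma inverse_add_Lipschitz:
  fixes c x y :: real
  assumes "0 < c" "0 \<le> x" "0 \<le> y"
  shows "\<bar>1 / (c + x) - 1 / (c + y)\<bar> \<le> \<bar>x - y\<bar> / c\<^sup>2"
proof -
  have "1 / (c + x) - 1 / (c + y) = (y - x) / ((c + x) * (c + y))"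
    using assms by (simp add: field_simps)
  then have "\<bar>1 / (c + x) - 1 / (c + y)\<bar> = \<bar>x - y\<bar> / ((c + x) * (c + y))"
    using assms by (simp add: abs_mult abs_minus_commute)
  also have "\<dots> \<le> \<bar>x - y\<bar> / c\<^sup>2"
    unfolding power2_eq_square using assms by (intro divide_left_mono mult_mono mult_pos_pos) auto
  finally show ?thesis .
qed

text \<open>One period of digits acts as a contraction with fixed point \<open>per_tail\<close>,
  which gives convergence along all residues modulo 4 at once.\<close>

lemma cfrac_fin_cycle_LIMSEQ:
  "(\<lambda>k. cfrac_fin 0 (stake k (cycle [2, 2, 1, 2]))) \<longlonglongrightarrow> per_tail"
proof -
  define s :: "nat stream" where "s = cycle [2, 2, 1, 2]"
  define e where "e k = cfrac_fin 0 (stake k s)" for k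
  have s: "s = 2 ## 2 ## 1 ## 2 ## s"
    unfolding s_def by (subst cycle_decomp) auto
  have step: "e (k + 4) = 1 / (2 + 1 / (2 + 1 / (1 + 1 / (2 + e k))))" for k
  proof -
    have "stake (k + 4) s = 2 # 2 # 1 # 2 # stake k s"
      by (subst s) (simp add: numeral_eq_Suc)
    then show ?thesis unfolding e_def
      by (simp add: cfrac_fin_split[of "Suc 0"] cfrac_fin_split[of 2])
  qed
  have sset: "sset s = {1, 2}"
    unfolding s_def by auto
  have e01: "0 \<le> e k" "e k \<le> 1" for k
  proof -
    have "set (stake k s) \<subseteq> {1, 2}"
      using sset by (auto simp: set_conv_nth sset_range)
    then have "0 \<notin> set (stake k s)" by auto
    then show "0 \<le> e k" "e k \<le> 1"
      unfolding e_def by (auto intro: cfrac_fin_le_1 cfrac_fin_nonneg)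
  qed
  have t: "0 \<le> per_tail" "per_tail \<le> 1" using per_tail_bounds by auto
  have contr: "\<bar>e (k + 4) - per_tail\<bar> \<le> \<bar>e k - per_tail\<bar> / 16" for k
  proof -
    define x y where "x = e k" and "y = per_tail"
    have xy: "0 \<le> x" "0 \<le> y" using e01 t by (auto simp: x_def y_def)
    let ?x1 = "1 / (2 + x)" and ?y1 = "1 / (2 + y)"
    let ?x2 = "1 / (1 + ?x1)" and ?y2 = "1 / (1 + ?y1)"
    let ?x3 = "1 / (2 + ?x2)" and ?y3 = "1 / (2 + ?y2)"
    have 1: "\<bar>?x1 - ?y1\<bar> \<le> \<bar>x - y\<bar> / 4" using inverse_add_Lipschitz[of 2 x y] xy by simp
    have 2: "\<bar>?x2 - ?y2\<bar> \<le> \<bar>?x1 - ?y1\<bar>" using inverse_add_Lipschitz[of 1 ?x1 ?y1] xy by simp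
    have 3: "\<bar>?x3 - ?y3\<bar> \<le> \<bar>?x2 - ?y2\<bar> / 4" using inverse_add_Lipschitz[of 2 ?x2 ?y2] xy by simp
    have 4: "\<bar>1 / (2 + ?x3) - 1 / (2 + ?y3)\<bar> \<le> \<bar>?x3 - ?y3\<bar> / 4"
      using inverse_add_Lipschitz[of 2 ?x3 ?y3] xy by simp
    \<comment> \<open>The three digits 2 even give 1/64; the factor 1/16 =
      \<open>(1 / 2) ^ 4\<close> suffices and fits the bound \<open>8 * (1 / 2) ^ k\<close>, whose
      constant 8 covers \<open>k < 4\<close>.\<close>
    have "a \<le> r / 16" if "a \<le> b / 4" "b \<le> c / 4" "c \<le> d" "d \<le> r / 4" "0 \<le> r" for a b c d r :: real
      using that by linarith
    from this[OF 4 3 2 1] have "\<bar>1 / (2 + ?x3) - 1 / (2 + ?y3)\<bar> \<le> \<bar>x - y\<bar> / 16" by simp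
    moreover have "e (k + 4) = 1 / (2 + ?x3)" using step by (simp add: x_def)
    moreover have "per_tail = 1 / (2 + ?y3)" using per_tail_fixpoint by (simp add: y_def)
    ultimately show ?thesis unfolding x_def y_def by simp
  qed
  have bound: "\<bar>e k - per_tail\<bar> \<le> 8 * (1 / 2) ^ k" for k
  proof (induction k rule: less_induct)
    case (less k)
    show ?case
    proof (cases "k < 4")
      case True
      have "\<bar>e k - per_tail\<bar> \<le> 1" using e01[of k] t by linarith
      also have "(1::real) = 8 * (1 / 2) ^ 3" by (simp add: power3_eq_cube)
      also have "\<dots> \<le> 8 * (1 / 2) ^ k" using True by (intro mult_left_mono power_decreasing) auto
      finally show ?thesis .
    next
      case False
      then obtain j where j: "k = j + 4" by (metis add.commute le_Suc_ex not_less)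
      have "\<bar>e j - per_tail\<bar> \<le> 8 * (1 / 2) ^ j" using less j by auto
      moreover have "(1 / 2 :: real) ^ k = (1 / 2) ^ j / 16" by (simp add: j power_add power4_eq_xxxx)
      ultimately show ?thesis using contr[of j] by (simp add: j)
    qed
  qed
  have "(\<lambda>k. (1 / 2 :: real) ^ k) \<longlonglongrightarrow> 0"
    by (rule LIMSEQ_realpow_zero) simp_all
  then have lim: "(\<lambda>k. 8 * (1 / 2 :: real) ^ k) \<longlonglongrightarrow> 0"
    using tendsto_mult_right_zero by blast
  have "\<forall>\<^sub>F k in sequentially. norm (e k - per_tail) \<le> 8 * (1 / 2) ^ k"
    using bound by simp
  from Lim_null_comparison[OF this lim] have "(\<lambda>k. e k - per_tail) \<longlonglongrightarrow> 0" .
  then have "(\<lambda>k. e k) \<longlonglongrightarrow> per_tail" by (rule LIM_zero_cancel)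
  then show ?thesis unfolding e_def s_def .
qed

text \<open>The first continued fraction in \<open>alpha_star n\<close>; it recurs in the second
  one, behind \<open>2 * n - 1\<close> ones and a 2.\<close>

definition opt_tail :: "nat \<Rightarrow> real" where
  "opt_tail n = (gstep ^^ (2 * n - 2)) per_tail"

lemma opt_tail_bounds:
  assumes "n \<ge> 2"
  shows "15 / 26 \<le> opt_tail n" "opt_tail n \<le> 26 / 41"
  using gstep_pow_bounds2[of per_tail "2 * n - 2"] per_tail_bounds assms
  by (auto simp: opt_tail_def)

lemma inverse_two_opt_tail_bounds:
  assumes "n \<ge> 2"
  shows "41 / 108 \<le> 1 / (2 + opt_tail n)" "1 / (2 + opt_tail n) \<le> 26 / 67"
  using inverse_add_bounds[of "15 / 26" "opt_tail n" "26 / 41" 2] opt_tail_bounds[OF assms] by auto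

lemma alpha_star_eq:
  "alpha_star n = 2 + opt_tail n + (gstep ^^ (2 * n - 1)) (1 / (2 + opt_tail n))"
proof -
  let ?s = "replicate (2 * n - 2) 1 @- cycle [2, 2, 1, 2] :: nat stream"
  have t0: "0 \<le> per_tail" using per_tail_bounds by simp
  have o0: "0 \<le> opt_tail n" unfolding opt_tail_def by (rule gstep_pow_nonneg[OF t0])
  have 1: "(\<lambda>k. cfrac_fin 0 (stake k ?s)) \<longlonglongrightarrow> opt_tail n"
    unfolding opt_tail_def by (rule cfrac_fin_ones_LIMSEQ[OF cfrac_fin_cycle_LIMSEQ t0])
  have 2: "(\<lambda>k. cfrac_fin 0 (stake k (2 ## ?s))) \<longlonglongrightarrow> 1 / (real 2 + opt_tail n)"
    by (rule cfrac_fin_SCons_LIMSEQ[OF 1 _ o0]) simp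
  have 3: "(\<lambda>k. cfrac_fin 0 (stake k (replicate (2 * n - 1) 1 @- 2 ## ?s)))
      \<longlonglongrightarrow> (gstep ^^ (2 * n - 1)) (1 / (real 2 + opt_tail n))"
    by (rule cfrac_fin_ones_LIMSEQ[OF 2]) (use o0 in auto)
  have "(replicate (2 * n - 1) 1 @ [2] @ replicate (2 * n - 2) 1) @- cycle [2, 2, 1, 2]
      = replicate (2 * n - 1) 1 @- 2 ## ?s" by simp
  then show ?thesis
    unfolding alpha_star_def cfrac_def using limI[OF 1] limI[OF 3] by simp
qed

text \<open>The lower bound excludes the centre digit 1 and makes Legendre's criterion applicable;
  the upper bound limits the digits.\<close>

lemma alpha_star_bounds:
  assumes "n \<ge> 2"
  shows "3 < alpha_star n" "alpha_star n \<le> 3.4"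
proof -
  have "15 / 26 \<le> (gstep ^^ (2 * n - 1)) (1 / (2 + opt_tail n))"
    "(gstep ^^ (2 * n - 1)) (1 / (2 + opt_tail n)) \<le> 26 / 41"
    using gstep_pow_bounds2[of "1 / (2 + opt_tail n)" "2 * n - 1"]
      inverse_two_opt_tail_bounds[OF assms] assms by auto
  then show "3 < alpha_star n" "alpha_star n \<le> 3.4"
    unfolding alpha_star_eq using opt_tail_bounds[OF assms] by auto
qed

text \<open>
  The case of a digit 2 whose shorter adjacent run of ones has length \<open>k < 2 n - 2\<close>: with \<open>k\<close> even
  \<open>\<lambda>\<close> is too small, with \<open>k\<close> odd it is too large.
\<close>

lemma min_run_gap:
  assumes n: "n \<ge> 2" and k: "k + 3 \<le> 2 * n"
    and z: "4 / 11 \<le> z" "z \<le> 11 / 26" "4 / 11 \<le> z'" "z' \<le> 11 / 15"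
  shows "gap n \<le> (-1) ^ k * (alpha_star n - (2 + (gstep ^^ k) z + (gstep ^^ k) z'))"
proof -
  define s where "s = 1 / (2 + opt_tail n)"
  have s: "4 / 11 \<le> s" "s \<le> 11 / 26"
    using inverse_two_opt_tail_bounds[OF n] by (auto simp: s_def)
  define j where "j = 2 * n - 2 - k"
  have j: "j \<ge> 1" "2 * n - 2 = k + j" "2 * n - 1 = k + Suc j" using k by (auto simp: j_def)
  \<comment> \<open>The two summands of \<open>alpha_star n\<close> with their \<open>k\<close>
    outermost ones stripped off.\<close>
  define p q where "p = (gstep ^^ j) per_tail" and "q = (gstep ^^ Suc j) s"
  have e: "alpha_star n = 2 + (gstep ^^ k) p + (gstep ^^ k) q"
    unfolding alpha_star_eq s_def[symmetric] p_def q_def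
    unfolding opt_tail_def j(2,3) funpow_add by simp
  note t = per_tail_bounds
  have p: "15 / 26 \<le> p" "p \<le> 11 / 15"
    using gstep_pow_bounds1[of per_tail j] t j by (auto simp: p_def)
  have q: "15 / 26 \<le> q" "q \<le> 11 / 15"
    using gstep_pow_bounds1[of s "Suc j"] s j by (auto simp: q_def simp del: funpow.simps)
  \<comment> \<open>Twice 15/26 would fall short of 11/26 + 11/15, the bound for
    \<open>z + z'\<close>, so one estimate is sharpened: that of \<open>p\<close> for
    \<open>j = 1\<close>, that of \<open>q\<close> otherwise.\<close>
  have "15 / 26 + 41 / 67 \<le> p + q"
  proof (cases "j = 1")
    case True
    then have "1 / (1 + 11 / 26) \<le> p" unfolding p_def
      using gstep_bounds[of "4 / 11" per_tail "11 / 26"] t by simp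
    then show ?thesis using q by simp
  next
    case False
    then have "41 / 67 \<le> q" unfolding q_def using gstep_pow_bounds3[of s "Suc j"] s j by auto
    then show ?thesis using p by simp
  qed
  then have "gap n \<le> (-1) ^ k * ((gstep ^^ k) p + (gstep ^^ k) q - (gstep ^^ k) z - (gstep ^^ k) z')"
    using p q z k by (intro gstep_pow_sum_gap) auto
  then show ?thesis unfolding e by (simp add: algebra_simps)
qed

text \<open>Rules out \<open>2 * n - 1\<close> ones on both sides: two inner tails beginning with 1
  sum to at least 15/13, more than the bound 11/26 + 108/149 for those of
  \<open>alpha_star n\<close>, and \<open>2 * n - 2\<close> is even.\<close>

lemma long_run_gap:
  assumes n: "n \<ge> 2" and z: "15 / 26 \<le> z" "z \<le> 1" "15 / 26 \<le> z'" "z' \<le> 1"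
  shows "alpha_star n + gap n \<le> 2 + (gstep ^^ (2 * n - 2)) z + (gstep ^^ (2 * n - 2)) z'"
proof -
  define s where "s = 1 / (2 + opt_tail n)"
  have s: "41 / 108 \<le> s" "s \<le> 26 / 67"
    using inverse_two_opt_tail_bounds[OF n] by (auto simp: s_def)
  then have gs: "67 / 93 \<le> gstep s" "gstep s \<le> 108 / 149"
    using gstep_bounds[of "41 / 108" s "26 / 67"] by auto
  have "2 * n - 1 = Suc (2 * n - 2)" using n by simp
  then have "(gstep ^^ (2 * n - 1)) s = (gstep ^^ (2 * n - 2)) (gstep s)"
    by (simp only: funpow_Suc_right o_apply)
  then have e: "alpha_star n = 2 + (gstep ^^ (2 * n - 2)) per_tail + (gstep ^^ (2 * n - 2)) (gstep s)"
    unfolding alpha_star_eq s_def[symmetric] by (simp add: opt_tail_def)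
  have "gap n \<le> (-1) ^ (2 * n - 2) * ((gstep ^^ (2 * n - 2)) z + (gstep ^^ (2 * n - 2)) z'
      - (gstep ^^ (2 * n - 2)) per_tail - (gstep ^^ (2 * n - 2)) (gstep s))"
    using n z gs per_tail_bounds by (intro gstep_pow_sum_gap) auto
  moreover have "(-1::real) ^ (2 * n - 2) = 1" by simp
  ultimately show ?thesis unfolding e by simp
qed

subsection \<open>Forbidden words\<close>

text \<open>
  A stretch of a continued fraction with digits \<open>a i\<close>, where \<open>u i = [0; a (i + 1), a (i + 2), \<dots>]\<close> and
  \<open>y i = [0; a (i - 1), a (i - 2), \<dots>]\<close>, so that \<open>\<lambda> i = a i + u i + y i\<close>. Integer indices make the
  notion invariant under the reflection \<open>i \<mapsto> - i\<close>, which exchanges \<open>u\<close> and \<open>y\<close>.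
\<close>

locale window =
  fixes n :: nat and N M :: int and a u y :: "int \<Rightarrow> real"
  assumes n: "n \<ge> 2"
    and digit: "N \<le> i \<Longrightarrow> i \<le> M \<Longrightarrow> a i = 1 \<or> a i = 2"
    and u01: "N \<le> i \<Longrightarrow> i \<le> M \<Longrightarrow> 0 \<le> u i \<and> u i \<le> 1"
    and y01: "N \<le> i \<Longrightarrow> i \<le> M \<Longrightarrow> 0 \<le> y i \<and> y i \<le> 1"
    and u_rec: "N \<le> i \<Longrightarrow> i < M \<Longrightarrow> u i = 1 / (a (i + 1) + u (i + 1))"
    and y_rec: "N < i \<Longrightarrow> i \<le> M \<Longrightarrow> y i = 1 / (a (i - 1) + y (i - 1))"
    and bound: "N \<le> i \<Longrightarrow> i \<le> M \<Longrightarrow> a i + u i + y i < alpha_star n + gap n"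
begin

lemma reflect: "window n (- M) (- N) (\<lambda>i. a (- i)) (\<lambda>i. y (- i)) (\<lambda>i. u (- i))"
proof
  fix i
  show "y (- i) = 1 / (a (- (i + 1)) + y (- (i + 1)))" if "- M \<le> i" "i < - N"
    using y_rec[of "- i"] that by simp
  show "u (- i) = 1 / (a (- (i - 1)) + u (- (i - 1)))" if "- M < i" "i \<le> - N"
    using u_rec[of "- i"] that by simp
  show "a (- i) + y (- i) + u (- i) < alpha_star n + gap n" if "- M \<le> i" "i \<le> - N"
    using bound[of "- i"] that by simp
qed (use n digit u01 y01 in auto)

text \<open>A digit 1 or 2 turns bounds \<open>l\<close>, \<open>h\<close> into
  \<open>1 / (2 + h)\<close>, \<open>1 / (1 + l)\<close>; four rounds starting from 0 and 1 yield
  4/11 and 11/15.\<close>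

lemma u_bounds:
  assumes "N \<le> i" "i + 4 \<le> M"
  shows "4 / 11 \<le> u i" "u i \<le> 11 / 15"
proof -
  have step: "1 / (2 + h) \<le> u j \<and> u j \<le> 1 / (1 + l)"
    if "j' = j + 1" "N \<le> j" "j < M" "l \<le> u j'" "u j' \<le> h" "0 \<le> l" for j j' l h
  proof -
    have "1 / (2 + h) \<le> 1 / (1 + h)" using that by (intro divide_left_mono) auto
    moreover have "1 / (2 + l) \<le> 1 / (1 + l)" using that by (intro divide_left_mono) auto
    moreover have "u j = 1 / (1 + u (j + 1)) \<or> u j = 1 / (2 + u (j + 1))"
      using digit[of "j + 1"] u_rec[of j] that by auto
    ultimately show ?thesis
      using inverse_add_bounds[of l "u (j + 1)" h 1] inverse_add_bounds[of l "u (j + 1)" h 2] that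
      by fastforce
  qed
  have "1 / (2 + 1) \<le> u (i + 3) \<and> u (i + 3) \<le> 1 / (1 + 0)"
    using step[of "i + 4" "i + 3" 0 1] u01[of "i + 4"] assms by simp
  then have "1 / 3 \<le> u (i + 2) \<and> u (i + 2) \<le> 3 / 4"
    using step[of "i + 3" "i + 2" "1 / 3" 1] assms by simp
  then have "4 / 11 \<le> u (i + 1) \<and> u (i + 1) \<le> 3 / 4"
    using step[of "i + 2" "i + 1" "1 / 3" "3 / 4"] assms by simp
  then show "4 / 11 \<le> u i" "u i \<le> 11 / 15"
    using step[of "i + 1" i "4 / 11" "3 / 4"] assms by auto
qed

lemma u_bounds_two:
  assumes "N \<le> i" "i + 5 \<le> M" "a (i + 1) = 2"
  shows "u i \<le> 11 / 26"
  using u_rec[of i] inverse_add_bounds[of "4 / 11" "u (i + 1)" "11 / 15" 2] u_bounds[of "i + 1"] assms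
  by auto

lemma u_bounds_one:
  assumes "N \<le> i" "i + 5 \<le> M" "a (i + 1) = 1"
  shows "15 / 26 \<le> u i"
  using u_rec[of i] inverse_add_bounds[of "4 / 11" "u (i + 1)" "11 / 15" 1] u_bounds[of "i + 1"] assms
  by auto

lemma u_ones:
  assumes "N \<le> i" "i + int k \<le> M" "\<And>j. 1 \<le> j \<Longrightarrow> j \<le> k \<Longrightarrow> a (i + int j) = 1"
  shows "u i = (gstep ^^ k) (u (i + int k))"
  using assms
proof (induction k)
  case (Suc k)
  have "u i = (gstep ^^ k) (u (i + int k))" using Suc by simp
  moreover have "u (i + int k) = gstep (u (i + int (Suc k)))"
    using u_rec[of "i + int k"] Suc.prems(1,2) Suc.prems(3)[of "Suc k"]
    by (simp add: gstep_def ac_simps)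
  ultimately show ?case by (simp add: funpow_swap1)
qed simp

abbreviation ones :: "int \<Rightarrow> nat \<Rightarrow> bool" where
  "ones i k \<equiv> (\<forall>j. 1 \<le> j \<and> j \<le> k \<longrightarrow> a (i + int j) = 1 \<and> a (i - int j) = 1)"

lemma y_bounds:
  assumes "N + 4 \<le> i" "i \<le> M"
  shows "4 / 11 \<le> y i" "y i \<le> 11 / 15"
  using window.u_bounds[OF reflect, of "- i"] assms by simp_all

lemma y_bounds_two:
  assumes "N + 5 \<le> i" "i \<le> M" "a (i - 1) = 2"
  shows "y i \<le> 11 / 26"
  using window.u_bounds_two[OF reflect, of "- i"] assms by simp

lemma y_bounds_one:
  assumes "N + 5 \<le> i" "i \<le> M" "a (i - 1) = 1"
  shows "15 / 26 \<le> y i"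
  using window.u_bounds_one[OF reflect, of "- i"] assms by simp

lemma y_ones:
  assumes "N \<le> i - int k" "i \<le> M" "\<And>j. 1 \<le> j \<Longrightarrow> j \<le> k \<Longrightarrow> a (i - int j) = 1"
  shows "y i = (gstep ^^ k) (y (i - int k))"
proof -
  have "y (- (- i)) = (gstep ^^ k) (y (- (- i + int k)))"
    by (rule window.u_ones[OF reflect]) (use assms in simp_all)
  then show ?thesis by simp
qed

text \<open>The tail past the ones on the right begins with 2 and is at most 11/26; the left one is
  only known to be at most 11/15. By \<open>min_run_gap\<close>, odd \<open>k\<close> violates
  \<open>bound\<close> and even \<open>k\<close> stays below \<open>alpha_star n\<close>.\<close>

lemma first_two_right:
  assumes i: "N + int k + 5 \<le> i" "i + int k + 5 \<le> M" and k: "k + 3 \<le> 2 * n"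
    and center: "a i = 2" and ones: "ones i k" and two: "a (i + int k + 1) = 2"
  shows "even k" "a i + u i + y i < alpha_star n"
proof -
  define z z' where "z = u (i + int k)" and "z' = y (i - int k)"
  have z: "4 / 11 \<le> z" "z \<le> 11 / 26"
    using u_bounds[of "i + int k"] u_bounds_two[of "i + int k"] i two by (auto simp: z_def)
  have z': "4 / 11 \<le> z'" "z' \<le> 11 / 15"
    using y_bounds[of "i - int k"] i by (auto simp: z'_def)
  have eq: "a i + u i + y i = 2 + (gstep ^^ k) z + (gstep ^^ k) z'"
    using u_ones[of i k] y_ones[of i k] i ones center by (auto simp: z_def z'_def)
  have g: "gap n \<le> (-1) ^ k * (alpha_star n - (a i + u i + y i))"
    using min_run_gap[OF n k z z'] eq by simp
  show "even k"
  proof (rule ccontr)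
    assume "odd k"
    then have "alpha_star n + gap n \<le> a i + u i + y i" using g by simp
    then show False using bound[of i] i by simp
  qed
  then show "a i + u i + y i < alpha_star n" using g gap_pos[of n] n by simp
qed

lemma first_two_left:
  assumes i: "N + int k + 5 \<le> i" "i + int k + 5 \<le> M" and k: "k + 3 \<le> 2 * n"
    and center: "a i = 2" and ones: "ones i k" and two: "a (i - int k - 1) = 2"
  shows "even k" "a i + u i + y i < alpha_star n"
proof -
  have o: "\<forall>j. 1 \<le> j \<and> j \<le> k \<longrightarrow> a (- (- i + int j)) = 1 \<and> a (- (- i - int j)) = 1"
    using ones by (simp add: algebra_simps)
  have t: "a (- (- i + int k + 1)) = 2"
    using two by (simp add: algebra_simps)
  have "even k \<and> a (- (- i)) + y (- (- i)) + u (- (- i)) < alpha_star n"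
    using window.first_two_right[OF reflect _ _ k _ o t] i center by simp
  then show "even k" "a i + u i + y i < alpha_star n" by auto
qed

text \<open>\<open>long_run_gap\<close> caps the shorter run at \<open>2 * n - 2\<close>; anything
  shorter falls under \<open>first_two_right\<close> or \<open>first_two_left\<close>.\<close>

lemma run_classification:
  assumes i: "N + 2 * int n + 5 \<le> i" "i + 2 * int n + 5 \<le> M" and center: "a i = 2"
  obtains (short) k where "k + 3 \<le> 2 * n" "even k" "ones i k"
      "a (i + int k + 1) = 2 \<or> a (i - int k - 1) = 2" "a i + u i + y i < alpha_star n"
    | (exact) "ones i (2 * n - 2)" "a (i + int (2 * n - 1)) = 2 \<or> a (i - int (2 * n - 1)) = 2"
proof -
  \<comment> \<open>\<open>P k\<close> marks a digit other than 1 at distance \<open>k + 1\<close>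
    on at least one side; the least such \<open>k\<close> is the length of the shorter run.\<close>
  define P where "P k \<longleftrightarrow> a (i + int k + 1) \<noteq> 1 \<or> a (i - int k - 1) \<noteq> 1" for k
  have dig: "a (i + int k) = 1 \<or> a (i + int k) = 2" "a (i - int k) = 1 \<or> a (i - int k) = 2"
    if "k \<le> 2 * n" for k
    using digit[of "i + int k"] digit[of "i - int k"] that i by auto
  have ex: "\<exists>k \<le> 2 * n - 2. P k"
  proof (rule ccontr)
    assume none: "\<not> ?thesis"
    have o: "ones i (2 * n - 1)"
    proof (intro allI impI)
      fix j assume "1 \<le> j \<and> j \<le> 2 * n - 1"
      then obtain k where k: "j = Suc k" "k \<le> 2 * n - 2" by (cases j) auto
      then have "\<not> P k" using none by auto
      then show "a (i + int j) = 1 \<and> a (i - int j) = 1"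
        by (auto simp: P_def k algebra_simps)
    qed
    let ?m = "2 * n - 2"
    have m: "int (2 * n - 1) = int ?m + 1" using n by auto
    have "a (i + int ?m + 1) = 1" "a (i - int ?m - 1) = 1"
      using o[rule_format, of "2 * n - 1"] n m by (auto simp: algebra_simps)
    then have "15 / 26 \<le> u (i + int ?m)" "15 / 26 \<le> y (i - int ?m)"
      using u_bounds_one[of "i + int ?m"] y_bounds_one[of "i - int ?m"] i n by auto
    moreover have "u (i + int ?m) \<le> 1" "y (i - int ?m) \<le> 1"
      using u01[of "i + int ?m"] y01[of "i - int ?m"] i n by auto
    moreover have "u i = (gstep ^^ ?m) (u (i + int ?m))" "y i = (gstep ^^ ?m) (y (i - int ?m))"
      using u_ones[of i ?m] y_ones[of i ?m] i n o by auto
    ultimately have "alpha_star n + gap n \<le> a i + u i + y i"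
      using long_run_gap[OF n, of "u (i + int ?m)" "y (i - int ?m)"] center by simp
    then show False using bound[of i] i by simp
  qed
  define k where "k = (LEAST k. P k)"
  obtain k0 where k0: "k0 \<le> 2 * n - 2" "P k0" using ex by auto
  have Pk: "P k" unfolding k_def using k0(2) by (rule LeastI)
  have kle: "k \<le> 2 * n - 2" using Least_le[of P, OF k0(2)] k0(1) by (simp add: k_def)
  have o: "ones i k"
  proof (intro allI impI)
    fix j assume j: "1 \<le> j \<and> j \<le> k"
    then obtain l where l: "j = Suc l" by (cases j) auto
    then have "\<not> P l" using j not_less_Least[of l P] by (auto simp: k_def)
    then show "a (i + int j) = 1 \<and> a (i - int j) = 1"
      by (auto simp: P_def l algebra_simps)
  qed
  have two: "a (i + int k + 1) = 2 \<or> a (i - int k - 1) = 2"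
  proof -
    have "Suc k \<le> 2 * n" using kle n by simp
    from dig[OF this] Pk show ?thesis by (auto simp: P_def algebra_simps)
  qed
  show thesis
  proof (cases "k + 3 \<le> 2 * n")
    case True
    have d: "N + int k + 5 \<le> i" "i + int k + 5 \<le> M" using True i by auto
    have "even k \<and> a i + u i + y i < alpha_star n"
      using two first_two_right[OF d True center o] first_two_left[OF d True center o] by blast
    then show thesis using short[OF True _ o two] by blast
  next
    case False
    then have "k = 2 * n - 2" using kle by simp
    then show thesis using exact o two n by (auto simp: algebra_simps)
  qed
qed

text \<open>
  Among the tails that begin with 2 and avoid 2121, the periodic one is the largest. At each position
  the digit that would make the tail larger is chosen, except the last, where 1 would create 2121.
\<close>

lemma periodic_step:
  assumes k: "N \<le> k - 2" "k + 10 \<le> M" and a1: "a (k + 1) = 2" and uk: "per_tail \<le> u k"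
  shows "a (k + 2) = 2" "a (k + 3) = 1" "a (k + 4) = 2" "a (k + 5) = 2" "per_tail \<le> u (k + 4)"
proof -
  define t3 where "t3 = 1 / (2 + per_tail)"
  define t2 where "t2 = 1 / (1 + t3)"
  define t1 where "t1 = 1 / (2 + t2)"
  note t = per_tail_bounds
  have t3: "1 / (2 + 11 / 26) \<le> t3" "t3 \<le> 1 / (2 + 4 / 11)"
    using inverse_add_bounds[of "4 / 11" per_tail "11 / 26" 2] t unfolding t3_def by auto
  have t2: "1 / (1 + 1 / 2) \<le> t2"
    using inverse_add_bounds[of 0 t3 "1 / 2" 1] t3 unfolding t2_def by auto
  have t1: "0 < t1" "t1 \<le> 1 / 2"
    using inverse_add_bounds[of 0 t2 t2 2] t2 unfolding t1_def by auto
  have tt: "per_tail = 1 / (2 + t1)"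
    using per_tail_fixpoint by (simp add: t1_def t2_def t3_def)
  \<comment> \<open>Strips one leading digit from a comparison of tails and reverses it, so the
    bounds on \<open>u\<close> alternate in direction.\<close>
  have cancel: "1 / (c + v) \<le> 1 / (c + w) \<Longrightarrow> 0 < c \<Longrightarrow> 0 \<le> v \<Longrightarrow> 0 \<le> w \<Longrightarrow> w \<le> v" for c v w :: real
    by (simp add: field_simps)
  have u0: "0 \<le> u j" if "k \<le> j" "j \<le> k + 6" for j using u01[of j] that k by auto
  have r: "u j = 1 / (a (j + 1) + u (j + 1))" if "k \<le> j" "j \<le> k + 5" for j
    using u_rec[of j] that k by auto
  have dig: "a j = 1 \<or> a j = 2" if "k \<le> j" "j \<le> k + 5" for j using digit[of j] that k by auto
  have one: "15 / 26 \<le> u j" if "a (j + 1) = 1" "k \<le> j" "j \<le> k + 4" for j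
    using u_bounds_one[of j] that k by auto
  have two: "u j \<le> 11 / 26" if "a (j + 1) = 2" "k \<le> j" "j \<le> k + 4" for j
    using u_bounds_two[of j] that k by auto
  have u1: "u (k + 1) \<le> t1"
    using cancel[of 2 t1 "u (k + 1)"] uk r[of k] a1 tt u0[of "k + 1"] t1 by simp
  show a2: "a (k + 2) = 2"
    using one[of "k + 1"] u1 t1 dig[of "k + 2"] by (auto simp: add.assoc)
  have u2: "t2 \<le> u (k + 2)"
    using cancel[of 2 "u (k + 2)" t2] u1 r[of "k + 1"] a2 u0[of "k + 2"] t2
    by (simp add: t1_def add.assoc)
  show a3: "a (k + 3) = 1"
    using two[of "k + 2"] u2 t2 dig[of "k + 3"] by (auto simp: add.assoc)
  have u3: "u (k + 3) \<le> t3"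
    using cancel[of 1 t3 "u (k + 3)"] u2 r[of "k + 2"] a3 u0[of "k + 3"] t3
    by (simp add: t2_def add.assoc)
  show a4: "a (k + 4) = 2"
    using one[of "k + 3"] u3 t3 dig[of "k + 4"] by (auto simp: add.assoc)
  show u4: "per_tail \<le> u (k + 4)"
    using cancel[of 2 "u (k + 4)" per_tail] u3 r[of "k + 3"] a4 u0[of "k + 4"] t
    by (simp add: t3_def add.assoc)
  \<comment> \<open>A 1 here would complete 2121, where the shorter run next to the 2 at
    \<open>k + 4\<close> has the odd length 1. The margins \<open>k - 2\<close> and
    \<open>k + 10\<close> are those \<open>first_two_left\<close> requires at
    \<open>k + 4\<close>.\<close>
  show "a (k + 5) = 2"
  proof (rule ccontr)
    assume "a (k + 5) \<noteq> 2"
    then have a5: "a (k + 5) = 1" using dig[of "k + 5"] by auto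
    have "ones (k + 4) 1"
    proof (intro allI impI)
      fix j :: nat assume "1 \<le> j \<and> j \<le> 1"
      then have "j = 1" by simp
      then show "a (k + 4 + int j) = 1 \<and> a (k + 4 - int j) = 1"
        using a3 a5 by (simp add: add.commute)
    qed
    moreover have "a (k + 4 - int 1 - 1) = 2" using a2 by (simp add: add.commute)
    ultimately have "even (1::nat)"
      using first_two_left[of 1 "k + 4"] k n a4 by auto
    then show False by simp
  qed
qed

text \<open>\<open>periodic_step\<close> reproduces its own hypotheses one period later, so 2, 2, 1,
  2 repeats until \<open>c\<close> is reached; in this pattern every 1 is followed by a 2.\<close>

lemma no_double_one_right:
  assumes "N \<le> k - 2" "a (k + 1) = 2" "per_tail \<le> u k" "k < c" "c + 10 \<le> M"
  shows "\<not> (a c = 1 \<and> a (c + 1) = 1)"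
  using assms
proof (induction "nat (c - k)" arbitrary: k rule: less_induct)
  case less
  have "k + 10 \<le> M" using less.prems by simp
  note s = periodic_step[OF less.prems(1) this less.prems(2,3)]
  show ?case
  proof (cases "c \<le> k + 4")
    case True
    then have "c = k + 1 \<or> c = k + 2 \<or> c = k + 3 \<or> c = k + 4" using less.prems by linarith
    then show ?thesis using s(1,3,4) less.prems(2) by (auto simp: add.assoc)
  next
    case False
    show ?thesis
      by (rule less.hyps[of "k + 4"]) (use False less.prems s(4,5) in \<open>simp_all add: add.assoc\<close>)
  qed
qed

lemma no_double_one_left:
  assumes "k + 2 \<le> M" "a (k - 1) = 2" "per_tail \<le> y k" "c < k" "N + 10 \<le> c"
  shows "\<not> (a c = 1 \<and> a (c - 1) = 1)"
proof -
  have "\<not> (a (- (- c)) = 1 \<and> a (- (- c + 1)) = 1)"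
    by (rule window.no_double_one_right[OF reflect, of "- k"]) (use assms in simp_all)
  then show ?thesis by simp
qed

section \<open>Indices whose value is at least \<open>alpha_star n\<close>\<close>

text \<open>A right tail \<open>z\<close> of at least \<open>per_tail\<close> makes the right side
  periodic, against the double one at \<open>c\<close>. Otherwise the left side must make up the
  deficit; this pushes \<open>y j\<close> above \<open>opt_tail n\<close> and makes the far left
  periodic, against the double one at \<open>d\<close>.\<close>

lemma exact_right_False:
  assumes i: "N + 4 * int n + 10 \<le> i" "i + 4 * int n + 10 \<le> M" and center: "a i = 2"
    and ones: "ones i (2 * n - 2)" and two: "a (i + int (2 * n - 1)) = 2"
    and ge: "alpha_star n \<le> a i + u i + y i"
    and c: "i + 4 * int n \<le> c" "c + 10 \<le> M" "a c = 1" "a (c + 1) = 1"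
    and d: "d \<le> i - 4 * int n" "N + 10 \<le> d" "a d = 1" "a (d - 1) = 1"
  shows False
proof -
  let ?m = "2 * n - 2"
  let ?T = "gstep ^^ ?m"
  have m1: "int (2 * n - 1) = 2 * int n - 1" and m: "int ?m = 2 * int n - 2"
    and Suc_m: "2 * n - 1 = Suc ?m" using n by auto
  define z z' where "z = u (i + int ?m)" and "z' = y (i - int ?m)"
  have z: "4 / 11 \<le> z" using u_bounds[of "i + int ?m"] i n by (auto simp: z_def)
  have z': "4 / 11 \<le> z'" using y_bounds[of "i - int ?m"] i n by (auto simp: z'_def)
  have uz: "u i = ?T z" and yz: "y i = ?T z'"
    using u_ones[of i ?m] y_ones[of i ?m] i n ones by (auto simp: z_def z'_def)
  show ?thesis
  proof (cases "per_tail \<le> z")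
    case True
    have "\<not> (a c = 1 \<and> a (c + 1) = 1)"
    proof (rule no_double_one_right[of "i + int ?m"])
      show "a (i + int ?m + 1) = 2" using two unfolding m m1 by (simp add: add.assoc)
    qed (use True c i n m in \<open>auto simp: z_def\<close>)
    then show False using c by simp
  next
    case False
    define w where "w = opt_tail n"
    define s where "s = 1 / (2 + w)"
    note ob = opt_tail_bounds[OF n, folded w_def]
    have s: "41 / 108 \<le> s" "s \<le> 26 / 67"
      using inverse_two_opt_tail_bounds[OF n] by (auto simp: s_def w_def)
    have gs: "67 / 93 \<le> gstep s" using gstep_bounds[of "41 / 108" s "26 / 67"] s by auto
    have "?T z < opt_tail n"
      unfolding opt_tail_def using False z per_tail_bounds by (subst gstep_pow_less_iff_even) auto
    moreover have "alpha_star n = 2 + opt_tail n + ?T (gstep s)"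
      unfolding alpha_star_eq Suc_m s_def w_def by (simp only: funpow_Suc_right o_apply)
    ultimately have "?T (gstep s) < ?T z'"
      using ge uz yz center by simp
    then have z's: "gstep s < z'" using z' gs by (subst (asm) gstep_pow_less_iff_even) auto
    have "a (i - int ?m - 1) = 1"
      using y_bounds_two[of "i - int ?m"] digit[of "i - int ?m - 1"] z's gs i n by (auto simp: z'_def)
    then have z'1: "z' = gstep (y (i - int ?m - 1))"
      and left1: "a (i - int (2 * n - 1)) = 1"
      using y_rec[of "i - int ?m"] i n unfolding m1 by (auto simp: z'_def gstep_def m algebra_simps)
    \<comment> \<open>The position just beyond the \<open>2 * n - 1\<close> ones to the left of
      \<open>i\<close>.\<close>
    define j where "j = i - 2 * int n"
    have j1: "i - int ?m - 1 = j + 1" using m by (simp add: j_def)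
    \<comment> \<open>One more 1 would force \<open>z'\<close> down to at most 26/41, below
      \<open>gstep s\<close>.\<close>
    have aj: "a j = 2"
    proof (rule ccontr)
      assume "a j \<noteq> 2"
      then have "a (j + 1 - 1) = 1" using digit[of j] i n by (auto simp: j_def)
      then have "15 / 26 \<le> y (j + 1)" using y_bounds_one[of "j + 1"] i n by (auto simp: j_def)
      moreover have "y (j + 1) \<le> 1" using y01[of "j + 1"] i n by (auto simp: j_def)
      ultimately have "z' \<le> 1 / (1 + 15 / 26)"
        unfolding z'1 j1 using gstep_bounds[of "15 / 26" "y (j + 1)" 1] by auto
      then show False using z's gs by simp
    qed
    have yj0: "0 \<le> y j" using y01[of j] i n by (auto simp: j_def)
    have "y (j + 1) = 1 / (2 + y j)" using y_rec[of "j + 1"] aj i n by (auto simp: j_def)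
    then have "gstep (1 / (2 + w)) < gstep (1 / (2 + y j))" using z's z'1 j1 by (simp add: s_def)
    then have yj: "w < y j" using yj0 ob by (simp add: gstep_def field_simps)
    have right: "a (j + int l) = 1" if "1 \<le> l" "l \<le> 2 * n - 1" for l
    proof (cases "l = 1")
      case True
      then show ?thesis using left1 unfolding m1 by (simp add: j_def algebra_simps)
    next
      case False
      then have "1 \<le> 2 * n - l \<and> 2 * n - l \<le> 2 * n - 2" using that by linarith
      then have "a (i - int (2 * n - l)) = 1" using ones by blast
      moreover have "i - int (2 * n - l) = j + int l" using that by (auto simp: j_def)
      ultimately show ?thesis by simp
    qed
    have dj: "N + 2 * int n + 5 \<le> j" "j + 2 * int n + 5 \<le> M" using i n by (auto simp: j_def)
    \<comment> \<open>Seen from \<open>j\<close>, the run to the right has \<open>2 * n - 1\<close>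
      ones, so in both cases the 2 that ends the shorter run lies to the left.\<close>
    from dj aj show ?thesis
    proof (cases rule: run_classification)
      case (short k)
      have "a (j + int k + 1) = 1" using right[of "Suc k"] short by (simp add: algebra_simps)
      then have "a (j - int k - 1) = 2" using short by auto
      then have b: "y (j - int k) \<le> 11 / 26"
        using y_bounds_two[of "j - int k"] dj short by auto
      have b0: "0 \<le> y (j - int k)" using y01[of "j - int k"] dj short by auto
      have y: "y j = (gstep ^^ k) (y (j - int k))" using y_ones[of j k] dj short by auto
      \<comment> \<open>Behind the first \<open>k\<close> ones \<open>opt_tail n\<close> still has
        \<open>l\<close> more, hence a larger inner tail than \<open>y j\<close>; even
        \<open>k\<close> preserves the order.\<close>
      define l where "l = ?m - k"
      have l: "?m = k + l" "l \<ge> 1" using short(1) by (auto simp: l_def)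
      have "15 / 26 \<le> (gstep ^^ l) per_tail"
        using gstep_pow_bounds1[of per_tail l] per_tail_bounds l by auto
      then have "y j < (gstep ^^ k) ((gstep ^^ l) per_tail)"
        unfolding y using b b0 short by (subst gstep_pow_less_iff_even) auto
      moreover have "w = (gstep ^^ k) ((gstep ^^ l) per_tail)"
        unfolding w_def opt_tail_def l(1) funpow_add by simp
      ultimately have "y j < w" by simp
      then show ?thesis using yj by simp
    next
      case exact
      have "a (j + int (2 * n - 1)) = 1" by (rule right) (use n in auto)
      then have two': "a (j - int (2 * n - 1)) = 2" using exact by auto
      have y: "y j = ?T (y (j - int ?m))" using y_ones[of j ?m] dj exact n by auto
      have b0: "0 \<le> y (j - int ?m)" using y01[of "j - int ?m"] dj n by auto
      have "?T per_tail < ?T (y (j - int ?m))" using yj y by (simp add: w_def opt_tail_def)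
      then have "per_tail < y (j - int ?m)"
        using b0 per_tail_bounds by (subst (asm) gstep_pow_less_iff_even) auto
      then have "\<not> (a d = 1 \<and> a (d - 1) = 1)"
        using two' d dj n m unfolding m1 by (intro no_double_one_left[of "j - int ?m"]) (auto simp: j_def algebra_simps)
      then show False using d by simp
    qed
  qed
qed

lemma exact_left_False:
  assumes i: "N + 4 * int n + 10 \<le> i" "i + 4 * int n + 10 \<le> M" and center: "a i = 2"
    and ones: "ones i (2 * n - 2)" and two: "a (i - int (2 * n - 1)) = 2"
    and ge: "alpha_star n \<le> a i + u i + y i"
    and c: "i + 4 * int n \<le> c" "c + 10 \<le> M" "a c = 1" "a (c + 1) = 1"
    and d: "d \<le> i - 4 * int n" "N + 10 \<le> d" "a d = 1" "a (d - 1) = 1"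
  shows False
proof (rule window.exact_right_False[OF reflect, of "- i" "- d" "- c"])
  show "\<forall>j. 1 \<le> j \<and> j \<le> 2 * n - 2 \<longrightarrow> a (- (- i + int j)) = 1 \<and> a (- (- i - int j)) = 1"
    using ones by (simp add: algebra_simps)
  show "a (- (- i + int (2 * n - 1))) = 2" using two by (simp add: algebra_simps)
  show "alpha_star n \<le> a (- (- i)) + y (- (- i)) + u (- (- i))" using ge by simp
qed (use i center c d in \<open>simp_all add: add.commute\<close>)

lemma ge_center:
  assumes i: "N + 2 * int n + 5 \<le> i" "i + 2 * int n + 5 \<le> M"
    and ge: "alpha_star n \<le> a i + u i + y i"
  shows "a i = 2" "ones i (2 * n - 2)" "a (i + int (2 * n - 1)) = 2 \<or> a (i - int (2 * n - 1)) = 2"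
proof -
  have ai: "a i = 2"
  proof (rule ccontr)
    assume "a i \<noteq> 2"
    then have "a i = 1" using digit[of i] i by auto
    then show False using u01[of i] y01[of i] i ge alpha_star_bounds[OF n] by auto
  qed
  from i ai have "ones i (2 * n - 2) \<and> (a (i + int (2 * n - 1)) = 2 \<or> a (i - int (2 * n - 1)) = 2)"
  proof (cases rule: run_classification)
    case (short k)
    then show ?thesis using ge by linarith
  next
    case exact
    then show ?thesis by blast
  qed
  then show "a i = 2" "ones i (2 * n - 2)" "a (i + int (2 * n - 1)) = 2 \<or> a (i - int (2 * n - 1)) = 2"
    using ai by auto
qed

text \<open>The outer indices supply the double ones that break periodicity on both sides of
  \<open>i2\<close>: each is flanked by \<open>2 * n - 2 \<ge> 2\<close> ones, which gives
  \<open>d\<close> as \<open>i1 - 1\<close> and \<open>c\<close> as \<open>i3 + 1\<close>.\<close>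

lemma not_three_ge:
  assumes sep: "N + 4 * int n + 20 \<le> i1" "i1 + 4 * int n + 20 \<le> i2" "i2 + 4 * int n + 20 \<le> i3"
      "i3 + 4 * int n + 20 \<le> M"
    and ge: "alpha_star n \<le> a i1 + u i1 + y i1" "alpha_star n \<le> a i2 + u i2 + y i2"
      "alpha_star n \<le> a i3 + u i3 + y i3"
  shows False
proof -
  have o: "ones i1 (2 * n - 2)" "ones i3 (2 * n - 2)"
    using ge_center(2)[OF _ _ ge(1)] ge_center(2)[OF _ _ ge(3)] sep n by auto
  have n2: "2 \<le> 2 * n - 2" using n by simp
  have 1: "a (i1 - 1) = 1" "a (i1 - 1 - 1) = 1"
    using o(1)[rule_format, of 1] o(1)[rule_format, of 2] n2 by auto
  have 3: "a (i3 + 1) = 1" "a (i3 + 1 + 1) = 1"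
    using o(2)[rule_format, of 1] o(2)[rule_format, of 2] n2 by (auto simp: add.assoc)
  have 2: "N + 4 * int n + 10 \<le> i2" "i2 + 4 * int n + 10 \<le> M" "i2 + 4 * int n \<le> i3 + 1"
    "i3 + 1 + 10 \<le> M" "i1 - 1 \<le> i2 - 4 * int n" "N + 10 \<le> i1 - 1"
    using sep by auto
  have c: "a i2 = 2" "ones i2 (2 * n - 2)" "a (i2 + int (2 * n - 1)) = 2 \<or> a (i2 - int (2 * n - 1)) = 2"
    using ge_center[OF _ _ ge(2)] sep n by auto
  from c(3) show False
    using exact_right_False[OF 2(1,2) c(1,2) _ ge(2) 2(3,4) 3 2(5,6) 1]
      exact_left_False[OF 2(1,2) c(1,2) _ ge(2) 2(3,4) 3 2(5,6) 1] by auto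
qed

end

subsection \<open>Convergents and Legendre's criterion\<close>

text \<open>The complete quotients, whose integer parts \<open>pq\<close> are the partial
  quotients.\<close>

primrec cq :: "real \<Rightarrow> nat \<Rightarrow> real" where
  "cq \<alpha> 0 = \<alpha>"
| "cq \<alpha> (Suc i) = 1 / frac (cq \<alpha> i)"

definition pq :: "real \<Rightarrow> nat \<Rightarrow> int" where
  "pq \<alpha> i = \<lfloor>cq \<alpha> i\<rfloor>"

text \<open>Indices are shifted by one: the \<open>i\<close>-th convergent is \<open>cnum \<alpha> (Suc i) / cden \<alpha> (Suc i)\<close>.\<close>

fun cnum :: "real \<Rightarrow> nat \<Rightarrow> int" where
  "cnum \<alpha> 0 = 1"
| "cnum \<alpha> (Suc 0) = pq \<alpha> 0"
| "cnum \<alpha> (Suc (Suc i)) = pq \<alpha> (Suc i) * cnum \<alpha> (Suc i) + cnum \<alpha> i"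

fun cden :: "real \<Rightarrow> nat \<Rightarrow> int" where
  "cden \<alpha> 0 = 0"
| "cden \<alpha> (Suc 0) = 1"
| "cden \<alpha> (Suc (Suc i)) = pq \<alpha> (Suc i) * cden \<alpha> (Suc i) + cden \<alpha> i"

text \<open>With the shifted indices this is [0; a_{i-1}, ..., a_1] for \<open>i \<ge> 1\<close>,
  the backward tail \<open>y\<close> of a window; for \<open>i = 0\<close> it is 0 / 0 = 0.\<close>

definition cratio :: "real \<Rightarrow> nat \<Rightarrow> real" where
  "cratio \<alpha> i = cden \<alpha> (i - 1) / cden \<alpha> i"

definition lam :: "real \<Rightarrow> nat \<Rightarrow> real" where
  "lam \<alpha> i = cq \<alpha> i + cratio \<alpha> i"

lemma convergent_det:
  "cnum \<alpha> (Suc i) * cden \<alpha> i - cnum \<alpha> i * cden \<alpha> (Suc i) = (-1) ^ Suc i"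
  by (induction i) (auto simp: algebra_simps)

locale irrational =
  fixes \<alpha> :: real
  assumes irr: "\<alpha> \<notin> \<rat>"
begin

lemma cq_irrational: "cq \<alpha> i \<notin> \<rat>"
proof (induction i)
  case (Suc i)
  show ?case
  proof
    assume "cq \<alpha> (Suc i) \<in> \<rat>"
    then have "1 / cq \<alpha> (Suc i) \<in> \<rat>" by (intro Rats_divide) auto
    then have "frac (cq \<alpha> i) \<in> \<rat>" by simp
    then have "frac (cq \<alpha> i) + of_int \<lfloor>cq \<alpha> i\<rfloor> \<in> \<rat>" by (intro Rats_add) auto
    then show False using Suc by (simp add: frac_def)
  qed
qed (use irr in simp)

lemma frac_cq: "0 < frac (cq \<alpha> i)" "frac (cq \<alpha> i) < 1"
proof -
  have "cq \<alpha> i \<notin> \<int>" using cq_irrational[of i] by (auto elim!: Ints_cases)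
  then show "0 < frac (cq \<alpha> i)" by (simp add: frac_gt_0_iff)
qed (rule frac_lt_1)

lemma cq_gt_1: "1 < cq \<alpha> (Suc i)"
  using frac_cq[of i] by simp

lemma cq_rec: "cq \<alpha> i = pq \<alpha> i + 1 / cq \<alpha> (Suc i)"
  by (simp add: pq_def frac_def)

lemma pq_ge_1: "1 \<le> pq \<alpha> (Suc i)"
  using cq_gt_1[of i] by (simp add: pq_def le_floor_iff del: cq.simps)

lemma cden_pos: "0 \<le> cden \<alpha> i \<and> 1 \<le> cden \<alpha> (Suc i)"
proof (induction i)
  case (Suc i)
  have "1 * 1 \<le> pq \<alpha> (Suc i) * cden \<alpha> (Suc i)" using Suc pq_ge_1[of i] by (intro mult_mono) auto
  then show ?case using Suc by simp
qed simp

lemma cden_mono: "cden \<alpha> (Suc i) \<le> cden \<alpha> (Suc (Suc i))"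
proof -
  have "1 * cden \<alpha> (Suc i) \<le> pq \<alpha> (Suc i) * cden \<alpha> (Suc i)"
    using cden_pos[of i] pq_ge_1[of i] by (intro mult_right_mono) auto
  then show ?thesis using cden_pos[of i] unfolding cden.simps by linarith
qed

text \<open>Strict growth starts only here: \<open>cden \<alpha> 1\<close> and
  \<open>cden \<alpha> 2\<close> agree when the digit \<open>pq \<alpha> 1\<close> is 1.\<close>

lemma cden_strict: "cden \<alpha> (Suc (Suc i)) < cden \<alpha> (Suc (Suc (Suc i)))"
proof -
  have "1 * cden \<alpha> (Suc (Suc i)) \<le> pq \<alpha> (Suc (Suc i)) * cden \<alpha> (Suc (Suc i))"
    using cden_pos[of "Suc i"] pq_ge_1[of "Suc i"] by (intro mult_right_mono) auto
  then show ?thesis using cden_pos[of i] by simp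
qed

lemma cden_ge: "int i \<le> cden \<alpha> (Suc i)"
proof (induction i)
  case (Suc i)
  show ?case
  proof (cases i)
    case (Suc l)
    then show ?thesis using cden_strict[of l] \<open>int i \<le> cden \<alpha> (Suc i)\<close> by simp
  qed (use cden_pos[of 1] in simp)
qed (use cden_pos[of 0] in simp)

lemma cq_convergents:
  "\<alpha> * (cq \<alpha> (Suc i) * cden \<alpha> (Suc i) + cden \<alpha> i) = cq \<alpha> (Suc i) * cnum \<alpha> (Suc i) + cnum \<alpha> i"
proof (induction i)
  case 0
  have "\<alpha> = pq \<alpha> 0 + 1 / cq \<alpha> (Suc 0)" using cq_rec[of 0] by simp
  then have "\<alpha> * cq \<alpha> (Suc 0) = pq \<alpha> 0 * cq \<alpha> (Suc 0) + 1"
    using cq_gt_1[of 0] by (simp add: field_simps del: cq.simps)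
  then show ?case by (simp add: mult.commute del: cq.simps)
next
  case (Suc i)
  define x x' where "x = cq \<alpha> (Suc i)" and "x' = cq \<alpha> (Suc (Suc i))"
  have x': "1 < x'" using cq_gt_1 by (simp add: x'_def del: cq.simps)
  have x: "x * x' = pq \<alpha> (Suc i) * x' + 1"
    using cq_rec[of "Suc i"] x' by (simp add: x_def x'_def field_simps del: cq.simps)
  have "\<alpha> * ((x * x') * cden \<alpha> (Suc i) + x' * cden \<alpha> i) = (x * x') * cnum \<alpha> (Suc i) + x' * cnum \<alpha> i"
    using arg_cong[OF Suc[folded x_def], of "\<lambda>v. x' * v"] by (simp add: algebra_simps)
  then show ?case unfolding x x'_def[symmetric]
    by (simp add: algebra_simps del: cq.simps)
qed

definition cerr :: "nat \<Rightarrow> real" where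
  "cerr i = cden \<alpha> i * \<alpha> - cnum \<alpha> i"

lemma cerr_eq: "cerr (Suc i) = (-1) ^ i / (cq \<alpha> (Suc i) * cden \<alpha> (Suc i) + cden \<alpha> i)"
proof -
  define x where "x = cq \<alpha> (Suc i)"
  define D where "D = x * cden \<alpha> (Suc i) + cden \<alpha> i"
  have D: "0 < D" unfolding D_def x_def
    using cden_pos[of i] cq_gt_1[of i] by (intro add_pos_nonneg mult_pos_pos) (auto simp del: cq.simps)
  have "cerr (Suc i) * D = cden \<alpha> (Suc i) * (\<alpha> * D) - cnum \<alpha> (Suc i) * D"
    by (simp add: cerr_def algebra_simps)
  also have "\<dots> = - of_int (cnum \<alpha> (Suc i) * cden \<alpha> i - cnum \<alpha> i * cden \<alpha> (Suc i))"
    using cq_convergents[of i] unfolding D_def x_def by (simp add: algebra_simps del: cq.simps)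
  also have "\<dots> = (-1) ^ i" unfolding convergent_det by simp
  finally show ?thesis using D unfolding D_def x_def by (simp add: field_simps del: cq.simps)
qed

lemma cratio_bounds: "0 \<le> cratio \<alpha> (Suc i)" "cratio \<alpha> (Suc i) \<le> 1"
proof -
  show "0 \<le> cratio \<alpha> (Suc i)" using cden_pos[of i] by (simp add: cratio_def)
  have "cden \<alpha> i \<le> cden \<alpha> (Suc i)" using cden_mono[of "i - 1"] cden_pos[of 0] by (cases i) auto
  then show "cratio \<alpha> (Suc i) \<le> 1" using cden_pos[of i] by (simp add: cratio_def)
qed

lemma cratio_rec: "cratio \<alpha> (Suc (Suc i)) = 1 / (pq \<alpha> (Suc i) + cratio \<alpha> (Suc i))"
  using cden_pos[of i] pq_ge_1[of i] by (simp add: cratio_def field_simps)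

lemma lam_eq: "lam \<alpha> i = pq \<alpha> i + 1 / cq \<alpha> (Suc i) + cratio \<alpha> i"
  unfolding lam_def by (subst cq_rec) simp

lemma lam_gt_1: "1 < lam \<alpha> (Suc i)"
  using cratio_bounds[of i] cq_gt_1[of i] by (simp add: lam_def del: cq.simps)

text \<open>The link to the Lagrange constant: factoring \<open>cden \<alpha> (Suc i)\<close> out of
  the denominator in \<open>cerr_eq\<close> leaves \<open>lam \<alpha> (Suc i)\<close>.\<close>

lemma cden_cerr: "\<bar>cden \<alpha> (Suc i) * cerr (Suc i)\<bar> = 1 / lam \<alpha> (Suc i)"
proof -
  have d: "0 < real_of_int (cden \<alpha> (Suc i))" using cden_pos[of i] by linarith
  have e: "cq \<alpha> (Suc i) * cden \<alpha> (Suc i) + cden \<alpha> i = cden \<alpha> (Suc i) * lam \<alpha> (Suc i)"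
    using d by (simp add: lam_def cratio_def algebra_simps del: cq.simps)
  have "\<bar>cden \<alpha> (Suc i) * cerr (Suc i)\<bar> = cden \<alpha> (Suc i) * (1 / (cden \<alpha> (Suc i) * lam \<alpha> (Suc i)))"
    unfolding cerr_eq e using d lam_gt_1[of i] by (simp add: abs_mult power_abs del: cq.simps)
  then show ?thesis using d by simp
qed

lemma cerr_opposite_signs: "cerr i * cerr (Suc i) \<le> 0"
proof (cases i)
  case 0
  have "0 \<le> cerr 1" using cerr_eq[of 0] cq_gt_1[of 0] by (simp del: cq.simps)
  then show ?thesis using 0 by (simp add: cerr_def)
next
  case (Suc l)
  have pos: "0 < cq \<alpha> (Suc j) * cden \<alpha> (Suc j) + cden \<alpha> j" for j
    using cden_pos[of j] cq_gt_1[of j] by (intro add_pos_nonneg mult_pos_pos) (auto simp del: cq.simps)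
  have "cerr (Suc l) * cerr (Suc (Suc l)) = ((-1) ^ l * (-1) ^ Suc l) /
     ((cq \<alpha> (Suc l) * cden \<alpha> (Suc l) + cden \<alpha> l) *
      (cq \<alpha> (Suc (Suc l)) * cden \<alpha> (Suc (Suc l)) + cden \<alpha> (Suc l)))"
    unfolding cerr_eq by simp
  also have "(-1::real) ^ l * (-1) ^ Suc l = -1" by (simp flip: power_add)
  finally show ?thesis unfolding Suc
    using mult_pos_pos[OF pos[of l] pos[of "Suc l"]] by (simp add: divide_le_0_iff del: cq.simps)
qed

text \<open>The pair \<open>(p, q)\<close> need not be reduced, hence the factor \<open>w\<close>.\<close>

lemma legendre:
  fixes p q :: int
  assumes q: "1 \<le> q" and close: "\<bar>q * (q * \<alpha> - p)\<bar> < 1 / 2"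
  obtains i w where "1 \<le> w" "p = w * cnum \<alpha> (Suc i)" "q = w * cden \<alpha> (Suc i)"
proof -
  define P where "P i \<longleftrightarrow> q < cden \<alpha> (Suc (Suc i))" for i
  have "P (nat q)" using cden_ge[of "Suc (nat q)"] q by (simp add: P_def)
  then have Pl: "P (LEAST i. P i)" by (rule LeastI)
  define i where "i = (LEAST i. P i)"
  have q2: "q < cden \<alpha> (Suc (Suc i))" using Pl by (simp add: P_def i_def)
  have q1: "cden \<alpha> (Suc i) \<le> q"
  proof (cases i)
    case 0
    then show ?thesis using q by simp
  next
    case (Suc l)
    then have "\<not> P l" using not_less_Least[of l P] by (simp add: i_def)
    then show ?thesis using Suc by (simp add: P_def)
  qed
  define A B A' B' where "A = cnum \<alpha> (Suc i)" and "B = cden \<alpha> (Suc i)"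
    and "A' = cnum \<alpha> (Suc (Suc i))" and "B' = cden \<alpha> (Suc (Suc i))"
  define \<epsilon> :: int where "\<epsilon> = (-1) ^ Suc (Suc i)"
  have det: "A' * B - A * B' = \<epsilon>" using convergent_det[of \<alpha> "Suc i"]
    by (simp only: A_def B_def A'_def B'_def \<epsilon>_def)
  have \<epsilon>: "\<epsilon> * \<epsilon> = 1" by (simp add: \<epsilon>_def flip: power_add)
  \<comment> \<open>Coordinates of \<open>(p, q)\<close> in the basis of two consecutive
    convergents, integral because the determinant is a unit.\<close>
  define u v where "u = \<epsilon> * (q * A' - p * B')" and "v = \<epsilon> * (p * B - q * A)"
  have p_eq: "p = u * A + v * A'"
  proof -
    have "u * A + v * A' = \<epsilon> * (A' * B - A * B') * p" by (simp add: u_def v_def algebra_simps)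
    then show ?thesis using det \<epsilon> by simp
  qed
  have q_eq: "q = u * B + v * B'"
  proof -
    have "u * B + v * B' = \<epsilon> * (A' * B - A * B') * q" by (simp add: u_def v_def algebra_simps)
    then show ?thesis using det \<epsilon> by simp
  qed
  have B: "1 \<le> B" "1 \<le> B'" using cden_pos[of i] cden_pos[of "Suc i"] by (auto simp: B_def B'_def)
  show thesis
  proof (cases "v = 0")
    case True
    have "1 \<le> u" using q_eq True q B by (auto simp: zero_less_mult_iff int_one_le_iff_zero_less)
    then show thesis using that[of u i] p_eq q_eq True by (simp add: A_def B_def)
  next
    case False
    \<comment> \<open>As \<open>0 < q < B'\<close>, a nonzero \<open>v\<close> must be offset by a
      \<open>u\<close> of opposite sign.\<close>
    have uv: "u * v \<le> 0" "1 \<le> \<bar>u\<bar>"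
    proof -
      consider "1 \<le> v" | "v \<le> -1" using False by linarith
      then have "u * v \<le> 0 \<and> u \<noteq> 0"
      proof cases
        case 1
        have "1 * B' \<le> v * B'" using 1 B by (intro mult_right_mono) auto
        then have "u * B < 0" using q_eq q2 by (simp add: B'_def)
        then have "u < 0" using B by (simp add: mult_less_0_iff)
        then show ?thesis using 1 by (simp add: mult_le_0_iff)
      next
        case 2
        have "v * B' \<le> 0" using 2 B by (intro mult_nonpos_nonneg) auto
        then have "0 < u * B" using q_eq q by simp
        then have "0 < u" using B by (simp add: zero_less_mult_iff)
        then show ?thesis using 2 by (simp add: mult_le_0_iff)
      qed
      then show "u * v \<le> 0" "1 \<le> \<bar>u\<bar>" by auto
    qed
    define e e' where "e = cerr (Suc i)" and "e' = cerr (Suc (Suc i))"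
    have ee: "e * e' \<le> 0" using cerr_opposite_signs[of "Suc i"] by (simp add: e_def e'_def)
    have err: "q * \<alpha> - p = u * e + v * e'"
      unfolding p_eq q_eq e_def e'_def cerr_def A_def B_def A'_def B'_def by (simp add: algebra_simps)
    \<comment> \<open>The signs of coefficients and errors both alternate, so the two terms of
      \<open>err\<close> cannot cancel.\<close>
    have "0 \<le> (u * e) * (v * e')"
    proof -
      have "0 \<le> (of_int (u * v)) * (e * e')"
        using uv(1) ee by (intro mult_nonpos_nonpos) (auto simp flip: of_int_mult)
      then show ?thesis by (simp add: mult.assoc mult.left_commute)
    qed
    moreover have "\<bar>r\<bar> \<le> \<bar>r + s\<bar>" if "0 \<le> r * s" for r s :: real
      using that by (auto simp: zero_le_mult_iff)
    ultimately have "\<bar>u * e\<bar> \<le> \<bar>u * e + v * e'\<bar>" by blast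
    moreover have "1 * \<bar>e\<bar> \<le> \<bar>real_of_int u\<bar> * \<bar>e\<bar>" using uv(2) by (intro mult_right_mono) auto
    ultimately have le: "\<bar>e\<bar> \<le> \<bar>q * \<alpha> - p\<bar>" unfolding err by (simp add: abs_mult)
    \<comment> \<open>A nonzero integer, which \<open>close\<close> will force below 1 in absolute
      value.\<close>
    have v1: "1 \<le> \<bar>p * B - q * A\<bar>"
      using False by (auto simp: v_def)
    have "of_int (p * B - q * A) = q * e - B * (q * \<alpha> - p)"
      unfolding e_def cerr_def A_def B_def by (simp add: algebra_simps)
    then have "\<bar>of_int (p * B - q * A)\<bar> \<le> \<bar>q * e\<bar> + \<bar>B * (q * \<alpha> - p)\<bar>"
      by linarith
    also have "\<dots> \<le> q * \<bar>q * \<alpha> - p\<bar> + q * \<bar>q * \<alpha> - p\<bar>"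
    proof (rule add_mono)
      show "\<bar>q * e\<bar> \<le> q * \<bar>q * \<alpha> - p\<bar>"
        using q le by (simp add: abs_mult mult_left_mono)
      show "\<bar>B * (q * \<alpha> - p)\<bar> \<le> q * \<bar>q * \<alpha> - p\<bar>"
        using q1 B(1) by (simp add: abs_mult B_def mult_right_mono)
    qed
    also have "\<dots> < 1" using close q by (simp add: abs_mult)
    finally show thesis using v1 by linarith
  qed
qed

section \<open>From the Lagrange constant to the digits\<close>

text \<open>Only finitely many pairs have value at most \<open>1 / (l + e)\<close>, so their
  denominators are bounded by some \<open>K\<close>, which the denominators of the convergents
  outgrow.\<close>

lemma eventually_lam_less:
  assumes L: "lagrange_const \<alpha> = ereal l" and l: "0 < l" and e: "0 < e"
  shows "\<exists>N. \<forall>i \<ge> N. lam \<alpha> (Suc i) < l + e"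
proof -
  define F :: "(int \<times> nat) filter" where "F = inf cofinite (principal {(p, q). q \<ge> 1})"
  define f where "f = (\<lambda>(p :: int, q :: nat). ereal \<bar>real q * (real q * \<alpha> - real_of_int p)\<bar>)"
  have "inverse (Liminf F f) = ereal l" using L by (simp add: lagrange_const_def F_def f_def)
  then have "Liminf F f = inverse (ereal l)"
    using l by (cases "Liminf F f") (auto simp: field_simps split: if_splits)
  then have "Liminf F f = ereal (1 / l)" using l by (simp add: inverse_eq_divide)
  moreover have "1 / (l + e) < 1 / l" using l e by (intro divide_strict_left_mono) auto
  ultimately have "ereal (1 / (l + e)) < Liminf F f" by simp
  then have "eventually (\<lambda>x. ereal (1 / (l + e)) < f x) F" by (rule less_LiminfD)
  then have fin: "finite {x. \<not> (x \<in> {(p, q). q \<ge> 1} \<longrightarrow> ereal (1 / (l + e)) < f x)}"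
    by (simp add: F_def eventually_inf_principal eventually_cofinite)
  define bad where "bad = {x. \<not> (x \<in> {(p, q). q \<ge> 1} \<longrightarrow> ereal (1 / (l + e)) < f x)}"
  have "finite (snd ` bad)" using fin by (simp only: bad_def finite_imageI)
  then obtain K where K: "\<And>x. x \<in> snd ` bad \<Longrightarrow> x \<le> (K :: nat)"
    unfolding finite_nat_set_iff_bounded_le by blast
  have "lam \<alpha> (Suc i) < l + e" if i: "i \<ge> Suc K" for i
  proof -
    define x where "x = (cnum \<alpha> (Suc i), nat (cden \<alpha> (Suc i)))"
    have q: "int i \<le> cden \<alpha> (Suc i)" by (rule cden_ge)
    then have "snd x > K" using i by (simp add: x_def)
    then have "x \<notin> bad" using K by fastforce
    moreover have "1 \<le> snd x" using \<open>snd x > K\<close> by simp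
    ultimately have "ereal (1 / (l + e)) < f x" by (auto simp: bad_def x_def)
    moreover have "f x = ereal (1 / lam \<alpha> (Suc i))"
      using cden_cerr[of i] cden_pos[of i] by (simp add: f_def x_def cerr_def)
    ultimately have "1 / (l + e) < 1 / lam \<alpha> (Suc i)" by simp
    then show ?thesis using l e lam_gt_1[of i] by (simp add: field_simps)
  qed
  then show ?thesis by blast
qed

text \<open>By \<open>legendre\<close> each solution is \<open>w\<close> times a convergent, with
  \<open>w\<^sup>2 * l \<le> lam \<alpha> (Suc i)\<close>. So every solution comes from an
  \<open>i\<close> in \<open>I\<close>, and each such \<open>i\<close> admits finitely many
  \<open>w\<close>.\<close>

lemma infinite_lam_ge:
  assumes L: "lagrange_const \<alpha> = ereal l" and l: "2 < l" and att: "attainable \<alpha>"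
  shows "infinite {i. l \<le> lam \<alpha> (Suc i)}"
proof
  assume fin: "finite {i. l \<le> lam \<alpha> (Suc i)}"
  define S where "S = {(p :: int, q :: nat). q \<ge> 1 \<and>
       ereal \<bar>\<alpha> - real_of_int p / real q\<bar> \<le> 1 / (lagrange_const \<alpha> * ereal ((real q)\<^sup>2))}"
  define I where "I = {i. l \<le> lam \<alpha> (Suc i)}"
  define W where "W i = {1 .. \<lceil>lam \<alpha> (Suc i)\<rceil>}" for i
  define g where "g = (\<lambda>(i, w). (w * cnum \<alpha> (Suc i), nat (w * cden \<alpha> (Suc i))))"
  have "S \<subseteq> g ` Sigma I W"
  proof safe
    fix p :: int and q :: nat assume "(p, q) \<in> S"
    then have q: "q \<ge> 1" and le: "\<bar>\<alpha> - real_of_int p / real q\<bar> \<le> 1 / (l * (real q)\<^sup>2)"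
      using l by (auto simp: S_def L one_ereal_def)
    have "\<bar>real q * (real q * \<alpha> - p)\<bar> = (real q)\<^sup>2 * \<bar>\<alpha> - real_of_int p / real q\<bar>"
    proof -
      have "real q * (real q * \<alpha> - p) = (real q)\<^sup>2 * (\<alpha> - real_of_int p / real q)"
        using q by (simp add: power2_eq_square field_simps)
      then show ?thesis by (simp add: abs_mult)
    qed
    also have "\<dots> \<le> (real q)\<^sup>2 * (1 / (l * (real q)\<^sup>2))"
      using le by (intro mult_left_mono) auto
    also have "\<dots> = 1 / l" using q by simp
    finally have le': "\<bar>real q * (real q * \<alpha> - p)\<bar> \<le> 1 / l" .
    also have "1 / l < 1 / 2" using l by simp
    finally have "\<bar>real_of_int (int q) * (real_of_int (int q) * \<alpha> - p)\<bar> < 1 / 2" by simp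
    moreover have "1 \<le> int q" using q by simp
    ultimately obtain i w where w: "1 \<le> w" "p = w * cnum \<alpha> (Suc i)" "int q = w * cden \<alpha> (Suc i)"
      using legendre[of "int q" p] by blast
    have qr: "real q = of_int w * of_int (cden \<alpha> (Suc i))"
      using arg_cong[OF w(3), of real_of_int] by simp
    have wl: "(real_of_int w)\<^sup>2 * (1 / lam \<alpha> (Suc i)) \<le> 1 / l"
    proof -
      have "real q * (real q * \<alpha> - p) = (real_of_int w)\<^sup>2 * (cden \<alpha> (Suc i) * cerr (Suc i))"
        unfolding qr w(2) cerr_def by (simp add: power2_eq_square algebra_simps)
      then have "\<bar>real q * (real q * \<alpha> - p)\<bar> = (real_of_int w)\<^sup>2 * (1 / lam \<alpha> (Suc i))"
        unfolding cden_cerr[symmetric] by (simp add: abs_mult)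
      then show ?thesis using le' by simp
    qed
    have lp: "0 < lam \<alpha> (Suc i)" using lam_gt_1[of i] by simp
    have w2: "real_of_int w \<le> (real_of_int w)\<^sup>2" "1 \<le> (real_of_int w)\<^sup>2"
      using w(1) by (simp_all add: power2_eq_square mult_le_cancel_left1 mult_ge1_I)
    have wl': "(real_of_int w)\<^sup>2 * l \<le> lam \<alpha> (Suc i)" using wl lp l by (simp add: field_simps)
    have "1 * l \<le> (real_of_int w)\<^sup>2 * l" using w2 l by (intro mult_right_mono) auto
    then have "i \<in> I" using wl' by (simp add: I_def)
    moreover have "(real_of_int w)\<^sup>2 * 1 \<le> (real_of_int w)\<^sup>2 * l" using l by (intro mult_left_mono) auto
    then have "real_of_int w \<le> lam \<alpha> (Suc i)" using wl' w2 by linarith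
    then have "w \<in> W i" using w(1) by (simp add: W_def) linarith
    moreover have "(p, q) = g (i, w)" using w by (simp add: g_def flip: w(3))
    ultimately show "(p, q) \<in> g ` Sigma I W" by blast
  qed
  moreover have "finite (g ` Sigma I W)"
    using fin by (intro finite_imageI finite_SigmaI) (auto simp: I_def W_def)
  ultimately have "finite S" by (rule finite_subset)
  then show False using att by (simp add: attainable_def S_def)
qed

lemma eventually_window:
  assumes L: "lagrange_const \<alpha> = ereal (alpha_star n)" and n: "n \<ge> 2"
  obtains N where "\<And>M. window n (int N) M (\<lambda>i. pq \<alpha> (nat i))
      (\<lambda>i. 1 / cq \<alpha> (Suc (nat i))) (\<lambda>i. cratio \<alpha> (nat i))"
proof -
  have inv: "0 < 1 / cq \<alpha> (Suc i)" "1 / cq \<alpha> (Suc i) \<le> 1" for i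
    using cq_gt_1[of i] by (auto simp del: cq.simps)
  have "0 < alpha_star n" "0 < gap n" using alpha_star_bounds[OF n] gap_pos[of n] n by auto
  from eventually_lam_less[OF L this] obtain N0
    where N0: "\<And>i. i \<ge> N0 \<Longrightarrow> lam \<alpha> (Suc i) < alpha_star n + gap n" by blast
  have small: "lam \<alpha> (Suc i) < 3.5" if "i \<ge> N0" for i
    using N0[OF that] alpha_star_bounds[OF n] gap_le[of n] n by simp
  have le3: "pq \<alpha> (Suc i) \<le> 3" if "i \<ge> N0" for i
  proof (rule ccontr)
    assume "\<not> ?thesis"
    then have "4 \<le> real_of_int (pq \<alpha> (Suc i))" by linarith
    then show False using small[OF that] lam_eq[of "Suc i"] inv[of "Suc i"] cratio_bounds[of i] by linarith
  qed
  \<comment> \<open>A digit 3 is excluded through its neighbours, which are at most 3 by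
    \<open>le3\<close>: both tails are then at least 1/4, and 3 + 1/4 + 1/4 reaches 3.5.\<close>
  have le2: "pq \<alpha> (Suc (Suc i)) \<le> 2" if "i \<ge> N0" for i
  proof (rule ccontr)
    assume "\<not> ?thesis"
    then have 3: "3 \<le> real_of_int (pq \<alpha> (Suc (Suc i)))" by linarith
    have "cq \<alpha> (Suc (Suc (Suc i))) \<le> 4"
    proof -
      have "pq \<alpha> (Suc (Suc (Suc i))) \<le> 3" using le3[of "Suc (Suc i)"] that by simp
      then have "real_of_int (pq \<alpha> (Suc (Suc (Suc i)))) \<le> 3" by linarith
      then show ?thesis
        using cq_rec[of "Suc (Suc (Suc i))"] inv[of "Suc (Suc (Suc i))"] by linarith
    qed
    then have "1 / 4 \<le> 1 / cq \<alpha> (Suc (Suc (Suc i)))"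
      using cq_gt_1[of "Suc (Suc i)"] by (intro divide_left_mono) (auto simp del: cq.simps)
    moreover have "1 / 4 \<le> cratio \<alpha> (Suc (Suc i))"
    proof -
      have "real_of_int (pq \<alpha> (Suc i)) \<le> 3" "1 \<le> real_of_int (pq \<alpha> (Suc i))"
        using le3[OF that] pq_ge_1[of i] by linarith+
      then show ?thesis unfolding cratio_rec
        using cratio_bounds[of i] by (intro divide_left_mono) auto
    qed
    ultimately show False using small[of "Suc i"] that 3 lam_eq[of "Suc (Suc i)"] by simp
  qed
  have ex: "\<exists>j \<ge> N0. nat i = Suc (Suc j)" if "int (N0 + 2) \<le> i" for i
    using that by (intro exI[of _ "nat i - 2"]) linarith
  show thesis
  proof (rule that[of "N0 + 2"])
    fix M
    show "window n (int (N0 + 2)) M (\<lambda>i. pq \<alpha> (nat i))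
        (\<lambda>i. 1 / cq \<alpha> (Suc (nat i))) (\<lambda>i. cratio \<alpha> (nat i))"
    proof
      fix i
      show "real_of_int (pq \<alpha> (nat i)) = 1 \<or> real_of_int (pq \<alpha> (nat i)) = 2" if w: "int (N0 + 2) \<le> i" "i \<le> M"
      proof -
        obtain j where j: "j \<ge> N0" "nat i = Suc (Suc j)" using ex[OF w(1)] by blast
        then have "pq \<alpha> (nat i) = 1 \<or> pq \<alpha> (nat i) = 2"
          using le2[OF j(1)] pq_ge_1[of "Suc j"] by auto
        then show ?thesis by auto
      qed
      show "0 \<le> 1 / cq \<alpha> (Suc (nat i)) \<and> 1 / cq \<alpha> (Suc (nat i)) \<le> 1"
        using inv[of "nat i"] by linarith
      show "0 \<le> cratio \<alpha> (nat i) \<and> cratio \<alpha> (nat i) \<le> 1" if w: "int (N0 + 2) \<le> i" "i \<le> M"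
        using ex[OF w(1)] cratio_bounds by auto
      show "1 / cq \<alpha> (Suc (nat i)) =
          1 / (real_of_int (pq \<alpha> (nat (i + 1))) + 1 / cq \<alpha> (Suc (nat (i + 1))))"
        if w: "int (N0 + 2) \<le> i" "i < M"
      proof -
        have "nat (i + 1) = Suc (nat i)" using w by linarith
        then show ?thesis using cq_rec[of "Suc (nat i)"] by simp
      qed
      show "cratio \<alpha> (nat i) = 1 / (real_of_int (pq \<alpha> (nat (i - 1))) + cratio \<alpha> (nat (i - 1)))"
        if w: "int (N0 + 2) < i" "i \<le> M"
      proof -
        obtain j where j: "nat i = Suc (Suc j)" using ex[of i] w by auto
        then have "nat (i - 1) = Suc j" by linarith
        then show ?thesis using cratio_rec[of j] j by simp
      qed
      show "real_of_int (pq \<alpha> (nat i)) + 1 / cq \<alpha> (Suc (nat i)) + cratio \<alpha> (nat i)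
          < alpha_star n + gap n" if w: "int (N0 + 2) \<le> i" "i \<le> M"
      proof -
        obtain j where j: "j \<ge> N0" "nat i = Suc (Suc j)" using ex[OF w(1)] by blast
        then show ?thesis using N0[of "Suc j"] lam_eq[of "nat i"] by simp
      qed
    qed (rule n)
  qed
qed

lemma not_attainable_alpha_star:
  assumes L: "lagrange_const \<alpha> = ereal (alpha_star n)" and n: "n \<ge> 2"
  shows "\<not> attainable \<alpha>"
proof
  assume "attainable \<alpha>"
  then have inf: "infinite {i. alpha_star n \<le> lam \<alpha> (Suc i)}"
    using alpha_star_bounds[OF n] by (intro infinite_lam_ge[OF L]) auto
  have ex: "\<exists>i \<ge> k. alpha_star n \<le> lam \<alpha> i" for k
  proof -
    obtain j where "j \<ge> k" "alpha_star n \<le> lam \<alpha> (Suc j)"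
      using inf unfolding infinite_nat_iff_unbounded_le by blast
    then show ?thesis by (intro exI[of _ "Suc j"]) auto
  qed
  obtain N where N: "\<And>M. window n (int N) M (\<lambda>i. pq \<alpha> (nat i))
      (\<lambda>i. 1 / cq \<alpha> (Suc (nat i))) (\<lambda>i. cratio \<alpha> (nat i))"
    using eventually_window[OF L n] by blast
  obtain i1 where i1: "i1 \<ge> N + 4 * n + 20" "alpha_star n \<le> lam \<alpha> i1" using ex by blast
  obtain i2 where i2: "i2 \<ge> i1 + 4 * n + 20" "alpha_star n \<le> lam \<alpha> i2" using ex by blast
  obtain i3 where i3: "i3 \<ge> i2 + 4 * n + 20" "alpha_star n \<le> lam \<alpha> i3" using ex by blast
  have ge: "alpha_star n \<le> real_of_int (pq \<alpha> (nat (int i))) + 1 / cq \<alpha> (Suc (nat (int i)))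
      + cratio \<alpha> (nat (int i))" if "alpha_star n \<le> lam \<alpha> i" for i
    using that by (simp only: lam_eq nat_int)
  \<comment> \<open>The right end of the window is free, so it is placed just far enough beyond
    \<open>i3\<close>.\<close>
  show False
    by (rule window.not_three_ge[OF N[of "int (i3 + 4 * n + 20)"] _ _ _ _
          ge[OF i1(2)] ge[OF i2(2)] ge[OF i3(2)]]) (use i1(1) i2(1) i3(1) in linarith)+
qed

end

theorem theorem3:
  fixes n :: nat
  assumes "n \<ge> 2"
  shows "\<not> admissible (alpha_star n)"
proof
  assume "admissible (alpha_star n)"
  then obtain \<alpha> where \<alpha>: "\<alpha> \<notin> \<rat>" "attainable \<alpha>" "lagrange_const \<alpha> = ereal (alpha_star n)"
    by (auto simp: admissible_def)
  interpret irrational \<alpha> using \<alpha>(1) by unfold_locales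
  show False using not_attainable_alpha_star[OF \<alpha>(3) assms] \<alpha>(2) by simp
qed

end
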